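(* Let $\Gamma$ be a countably infinite discrete group. Then there exists $\alpha\in\mathrm{Rep}(\Gamma,\mathbb{U})$ whose conjugacy class is dense in $\mathrm{Rep}(\Gamma,\mathbb{U})$ and which is turbulent for the conjugation action of $\mathrm{Iso}(\mathbb{U})$ on $\mathrm{Rep}(\Gamma,\mathbb{U})$.
   Context: $\mathbb{U}$ denotes the Urysohn universal metric space, $\mathrm{Iso}(\mathbb{U})$ is its Polish group of isometries with the topology of pointwise convergence, and $\mathrm{Rep}(\Gamma,\mathbb{U})$ is the Polish space of all homomorphisms $\Gamma\to\mathrm{Iso}(\mathbb{U})$, a closed subspace of $\mathrm{Iso}(\mathbb{U})^\Gamma$. $\mathrm{Iso}(\mathbb{U})$ acts on it by conjugation, $(g.\pi)(\gamma)=g\pi(\gamma)g^{-1}$; conjugacy classes are the orbits of this action. Let a Polish group $G$ act continuously on a Polish space $X$. For $x\in X$, an open neighborhood $U$ of $x$ in $X$ and an open neighborhood $V$ of the unit in $G$, the local orbit $O(U,V)$ of $x$ is the set of all $y\in U$ for which there are $g_1,\ldots,g_n\in V$ with $y=g_n\cdots g_1.x$ and $g_i\cdots g_1.x\in U$ for all $i\leq n$. A point $x\in X$ is turbulent if for every open neighborhood $U$ of $x$ and every open neighborhood $V$ of $1_G\in G$, the local orbit $O(U,V)$ of $x$ is somewhere dense (i.e., its closure has non-empty interior). *)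

theory Defs
  imports "HOL-Analysis.Analysis" "HOL-Algebra.Group_Action"
begin

section \<open>The Urysohn space and its isometry group\<close>

definition Iso :: "('u::metric_space \<Rightarrow> 'u) monoid" where
  "Iso = \<lparr>carrier = {f. surj f \<and> (\<forall>x y. dist (f x) (f y) = dist x y)},
          mult = (\<circ>), one = id\<rparr>"

text \<open>
  The Urysohn space is, up to isometry, the unique complete separable metric space
  that is universal for separable metric spaces and ultrahomogeneous. Completeness and
  separability come from the class \<^class>\<open>polish_space\<close>, whose metric is complete.
  A separable metric space has at most continuum many points, so for universality it
  suffices to let the test spaces have their points in the type \<^typ>\<open>real\<close> (with an
  arbitrary metric).
\<close>

definition urysohn_universal :: "'u::polish_space itself \<Rightarrow> bool" where
  "urysohn_universal _ \<longleftrightarrow>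
     (\<forall>(M :: real set) d. Metric_space M d \<and> separable_space (Metric_space.mtopology M d) \<longrightarrow>
        (\<exists>f :: real \<Rightarrow> 'u. \<forall>x\<in>M. \<forall>y\<in>M. dist (f x) (f y) = d x y))"

definition ultrahomogeneous :: "'u::metric_space itself \<Rightarrow> bool" where
  "ultrahomogeneous _ \<longleftrightarrow>
     (\<forall>(F :: 'u set) (f :: 'u \<Rightarrow> 'u).
        finite F \<and> (\<forall>x\<in>F. \<forall>y\<in>F. dist (f x) (f y) = dist x y) \<longrightarrow>
        (\<exists>g\<in>carrier Iso. \<forall>x\<in>F. g x = f x))"

definition is_urysohn_space :: "'u::polish_space itself \<Rightarrow> bool" where
  "is_urysohn_space T \<longleftrightarrow> urysohn_universal T \<and> ultrahomogeneous T"

text \<open>The library topology on \<^typ>\<open>'u \<Rightarrow> 'u\<close> is the product topology, that is, the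
  topology of pointwise convergence.\<close>

definition Iso_topology :: "('u::metric_space \<Rightarrow> 'u) topology" where
  "Iso_topology = subtopology euclidean (carrier Iso)"


section \<open>Spaces of representations\<close>

text \<open>As usual for \<open>hom\<close>, only values on the carrier matter, so representations are taken
  to be extensional.\<close>

definition Rep :: "('g, 'm) monoid_scheme \<Rightarrow> ('g \<Rightarrow> 'u::metric_space \<Rightarrow> 'u) set" where
  "Rep \<Gamma> = hom \<Gamma> Iso \<inter> extensional (carrier \<Gamma>)"

definition Rep_topology ::
    "('g, 'm) monoid_scheme \<Rightarrow> ('g \<Rightarrow> 'u::metric_space \<Rightarrow> 'u) topology" where
  "Rep_topology \<Gamma> = subtopology (product_topology (\<lambda>_. Iso_topology) (carrier \<Gamma>)) (Rep \<Gamma>)"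

definition conj_action ::
    "('g, 'm) monoid_scheme \<Rightarrow> ('u \<Rightarrow> 'u) \<Rightarrow> ('g \<Rightarrow> 'u::metric_space \<Rightarrow> 'u) \<Rightarrow> ('g \<Rightarrow> 'u \<Rightarrow> 'u)"
  where
  "conj_action \<Gamma> g =
     (\<lambda>\<pi>\<in>Rep \<Gamma>. \<lambda>\<gamma>\<in>carrier \<Gamma>. g \<otimes>\<^bsub>Iso\<^esub> \<pi> \<gamma> \<otimes>\<^bsub>Iso\<^esub> inv\<^bsub>Iso\<^esub> g)"


section \<open>Turbulent points\<close>

text \<open>\<open>word_prod G g i\<close> is the product of \<open>g i, ..., g 1\<close> in this order; \<open>g 0\<close> is not used.\<close>

primrec word_prod :: "('a, 'm) monoid_scheme \<Rightarrow> (nat \<Rightarrow> 'a) \<Rightarrow> nat \<Rightarrow> 'a" where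
  "word_prod G g 0 = \<one>\<^bsub>G\<^esub>"
| "word_prod G g (Suc i) = g (Suc i) \<otimes>\<^bsub>G\<^esub> word_prod G g i"

definition local_orbit ::
    "('a, 'm) monoid_scheme \<Rightarrow> ('a \<Rightarrow> 'x \<Rightarrow> 'x) \<Rightarrow> 'x \<Rightarrow> 'x set \<Rightarrow> 'a set \<Rightarrow> 'x set" where
  "local_orbit G \<phi> x U V =
     {y \<in> U. \<exists>n g. (\<forall>i\<in>{1..n}. g i \<in> V \<and> \<phi> (word_prod G g i) x \<in> U) \<and>
                   y = \<phi> (word_prod G g n) x}"

definition turbulent_point ::
    "('a, 'm) monoid_scheme \<Rightarrow> 'a topology \<Rightarrow> 'x topology \<Rightarrow> ('a \<Rightarrow> 'x \<Rightarrow> 'x) \<Rightarrow> 'x \<Rightarrow> bool" where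
  "turbulent_point G TG X \<phi> x \<longleftrightarrow>
     x \<in> topspace X \<and>
     (\<forall>U V. openin X U \<and> x \<in> U \<and> openin TG V \<and> \<one>\<^bsub>G\<^esub> \<in> V \<longrightarrow>
        X interior_of (X closure_of local_orbit G \<phi> x U V) \<noteq> {})"


section \<open>Basic facts\<close>

lemma group_Iso: "group (Iso :: ('u::metric_space \<Rightarrow> 'u) monoid)"
proof (rule groupI)
  fix f :: "'u \<Rightarrow> 'u" assume "f \<in> carrier Iso"
  then have s: "surj f" and d: "\<And>x y. dist (f x) (f y) = dist x y" by (auto simp: Iso_def)
  have i: "inj f" by (rule injI) (metis d dist_eq_0_iff)
  have "surj (inv_into UNIV f)" using i by (simp add: inj_imp_surj_inv)
  moreover have "dist (inv_into UNIV f x) (inv_into UNIV f y) = dist x y" for x y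
    by (metis d s surj_f_inv_f)
  ultimately have "inv_into UNIV f \<in> carrier Iso" by (auto simp: Iso_def)
  then show "\<exists>g\<in>carrier Iso. g \<otimes>\<^bsub>Iso\<^esub> f = \<one>\<^bsub>Iso\<^esub>"
  proof (rule bexI[rotated])
    show "inv_into UNIV f \<otimes>\<^bsub>Iso\<^esub> f = \<one>\<^bsub>Iso\<^esub>" using i by (simp add: Iso_def)
  qed
next
  fix f g :: "'u \<Rightarrow> 'u" assume "f \<in> carrier Iso" "g \<in> carrier Iso"
  then show "f \<otimes>\<^bsub>Iso\<^esub> g \<in> carrier Iso"
    using comp_surj[of g f] by (simp add: Iso_def comp_def)
qed (simp_all add: Iso_def comp_assoc)

lemma topspace_Iso [simp]: "topspace Iso_topology = carrier Iso"
  by (simp add: Iso_topology_def)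

lemma topspace_Rep [simp]: "topspace (Rep_topology \<Gamma>) = Rep \<Gamma>"
  by (auto simp: Rep_topology_def Rep_def hom_def PiE_def)

lemma conj_action_Rep:
  assumes g: "g \<in> carrier (Iso :: ('u::metric_space \<Rightarrow> 'u) monoid)"
    and p: "\<pi> \<in> Rep \<Gamma>" and G: "group \<Gamma>"
  shows "conj_action \<Gamma> g \<pi> \<in> Rep \<Gamma>"
proof -
  interpret I: group "Iso :: ('u \<Rightarrow> 'u) monoid" by (rule group_Iso)
  interpret G: group \<Gamma> by fact
  have c: "\<And>a. a \<in> carrier \<Gamma> \<Longrightarrow> \<pi> a \<in> carrier Iso"
    and m: "\<And>a b. a \<in> carrier \<Gamma> \<Longrightarrow> b \<in> carrier \<Gamma> \<Longrightarrow> \<pi> (a \<otimes>\<^bsub>\<Gamma>\<^esub> b) = \<pi> a \<otimes>\<^bsub>Iso\<^esub> \<pi> b"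
    using p by (auto simp: Rep_def hom_def)
  have k: "inv\<^bsub>Iso\<^esub> g \<otimes>\<^bsub>Iso\<^esub> (g \<otimes>\<^bsub>Iso\<^esub> z) = z" if "z \<in> carrier Iso" for z
    using g that by (simp add: I.m_assoc[symmetric])
  show ?thesis
    using g p c by (auto simp: Rep_def[of \<Gamma>] hom_def conj_action_def m I.m_assoc k)
qed

lemma conj_action_mult:
  assumes g: "g \<in> carrier (Iso :: ('u::metric_space \<Rightarrow> 'u) monoid)" and h: "h \<in> carrier Iso"
    and p: "\<pi> \<in> Rep \<Gamma>" and G: "group \<Gamma>"
  shows "conj_action \<Gamma> (g \<otimes>\<^bsub>Iso\<^esub> h) \<pi> = conj_action \<Gamma> g (conj_action \<Gamma> h \<pi>)"
proof -
  interpret I: group "Iso :: ('u \<Rightarrow> 'u) monoid" by (rule group_Iso)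
  have c: "\<And>a. a \<in> carrier \<Gamma> \<Longrightarrow> \<pi> a \<in> carrier Iso"
    using p by (auto simp: Rep_def hom_def)
  have r: "conj_action \<Gamma> h \<pi> \<in> Rep \<Gamma>" by (rule conj_action_Rep[OF h p G])
  show ?thesis
  proof
    fix a
    have "conj_action \<Gamma> g (conj_action \<Gamma> h \<pi>) a =
      (\<lambda>\<gamma>\<in>carrier \<Gamma>. g \<otimes>\<^bsub>Iso\<^esub> conj_action \<Gamma> h \<pi> \<gamma> \<otimes>\<^bsub>Iso\<^esub> inv\<^bsub>Iso\<^esub> g) a"
      using r by (simp add: conj_action_def[of \<Gamma> g])
    also have "\<dots> = conj_action \<Gamma> (g \<otimes>\<^bsub>Iso\<^esub> h) \<pi> a"
      using g h p c by (auto simp: conj_action_def I.m_assoc I.inv_mult_group restrict_def)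
    finally show "conj_action \<Gamma> (g \<otimes>\<^bsub>Iso\<^esub> h) \<pi> a = conj_action \<Gamma> g (conj_action \<Gamma> h \<pi>) a" ..
  qed
qed

lemma conj_action_one:
  assumes p: "\<pi> \<in> Rep \<Gamma>"
  shows "conj_action \<Gamma> \<one>\<^bsub>Iso\<^esub> \<pi> = (\<pi> :: 'g \<Rightarrow> 'u::metric_space \<Rightarrow> 'u)"
proof
  interpret I: group "Iso :: ('u \<Rightarrow> 'u) monoid" by (rule group_Iso)
  fix a
  show "conj_action \<Gamma> \<one>\<^bsub>Iso\<^esub> \<pi> a = \<pi> a"
    using p by (auto simp: conj_action_def Rep_def hom_def extensional_def Pi_iff)
qed

lemma group_action_conj_action:
  assumes G: "group \<Gamma>"
  shows "group_action (Iso :: ('u::metric_space \<Rightarrow> 'u) monoid) (Rep \<Gamma>) (conj_action \<Gamma>)"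
proof -
  interpret I: group "Iso :: ('u \<Rightarrow> 'u) monoid" by (rule group_Iso)
  have B: "conj_action \<Gamma> g \<in> Bij (Rep \<Gamma>)" if g: "g \<in> carrier Iso" for g :: "'u \<Rightarrow> 'u"
  proof -
    have "bij_betw (conj_action \<Gamma> g) (Rep \<Gamma>) (Rep \<Gamma>)"
      by (rule bij_betw_byWitness[where f' = "conj_action \<Gamma> (inv\<^bsub>Iso\<^esub> g)"])
        (use g G in \<open>auto simp: conj_action_mult[symmetric] conj_action_one conj_action_Rep\<close>)
    then show ?thesis by (auto simp: Bij_def conj_action_def)
  qed
  have "conj_action \<Gamma> (g \<otimes>\<^bsub>Iso\<^esub> h) = compose (Rep \<Gamma>) (conj_action \<Gamma> g) (conj_action \<Gamma> h)"
    if "g \<in> carrier Iso" "h \<in> carrier Iso" for g h :: "'u \<Rightarrow> 'u"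
  proof
    fix p
    show "conj_action \<Gamma> (g \<otimes>\<^bsub>Iso\<^esub> h) p
        = compose (Rep \<Gamma>) (conj_action \<Gamma> g) (conj_action \<Gamma> h) p"
    proof (cases "p \<in> Rep \<Gamma>")
      case True
      then show ?thesis using that G by (simp add: compose_def conj_action_mult)
    next
      case False
      then show ?thesis by (simp add: compose_def conj_action_def)
    qed
  qed
  then have "conj_action \<Gamma> \<in> hom (Iso :: ('u \<Rightarrow> 'u) monoid) (BijGroup (Rep \<Gamma>))"
    using B by (auto simp: hom_def BijGroup_def)
  then show ?thesis
    by (simp add: group_action_def group_hom_def group_hom_axioms_def group_Iso group_BijGroup)
qed

end

theory Submission
  imports Defs
begin

text \<open>
  An action of \<open>\<Gamma>\<close> on the Urysohn space is determined, up to conjugacy, by a dense sequence of base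
  points and the distances between their translates, that is, by a translation invariant pseudometric
  on \<open>\<Gamma> \<times> \<nat>\<close>. Approximating an action up to conjugacy means approximating such distances for
  finitely many group elements and base points, because the Urysohn space is homogeneous up to small
  errors (\<open>urysohn_approx_homogeneous\<close>). So the theorem becomes a statement about invariant
  pseudometrics, and \<open>\<alpha>\<close> is obtained from one that is generic.

  The generic pseudometric \<open>\<rho>\<close> is the limit of stages that are bounded and in which only finitely
  many orbits have been decided (\<open>exists_generic\<close>). Countably many finite patterns of approximate
  distances are listed, and each of them is realized at its turn if it can be. Consequently every
  pattern that can be added to all late stages does occur in \<open>\<rho>\<close>, and the properties of \<open>\<rho>\<close> are
  proved by exhibiting extensions of stages. Two constructions provide them: gluing
  invariant pseudometrics along nearly isometric orbits (\<open>stage_gluing\<close>), and adding an orbit of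
  Katetov functions. The second yields the approximate extension property
  (\<open>generic_extension\<close>), by which a back-and-forth argument identifies the completion of \<open>\<rho>\<close> with the
  Urysohn space (\<open>urysohn_dense_embedding\<close>); left translations then become the representation \<open>\<alpha>\<close>
  (\<open>exists_generic_rep\<close>).

  The first construction yields paths (\<open>generic_path\<close>): for every invariant \<open>\<tau>\<close> there is a sequence of
  tuples inside \<open>\<rho>\<close>, with arbitrarily small steps, from the first base points to a tuple on which
  finitely many elements of \<open>\<Gamma>\<close> act as prescribed by \<open>\<tau>\<close>; along the sequence the distances change
  linearly. The end of such a path shows that the conjugacy class is dense. For turbulence, let \<open>\<tau>\<close>
  come from a representation \<open>\<pi>\<close> close to \<open>\<alpha>\<close>. Moving each tuple of the path to the base points by an
  isometry turns the path into a chain of conjugates of \<open>\<alpha>\<close>. The small steps make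
  the conjugating increments small, and linearity keeps the whole chain near \<open>\<alpha>\<close>, so the local orbit
  of \<open>\<alpha>\<close> accumulates at \<open>\<pi>\<close>. What makes small steps possible is that the stages are bounded: with each
  orbit of \<open>\<alpha>\<close> bounded, and \<open>\<tau>\<close> cut off at a large constant, the two ends of the path are at finite
  uniform distance over all of \<open>\<Gamma>\<close>.
\<close>

section \<open>Pseudometrics: gluing and Kuratowski suprema\<close>

text \<open>
  Nonnegativity on \<open>S\<close> is implied, since \<open>0 = d x x \<le> d x y + d y x = 2 * d x y\<close>.
\<close>

definition pseudometric_on :: "'a set \<Rightarrow> ('a \<Rightarrow> 'a \<Rightarrow> real) \<Rightarrow> bool" where
  "pseudometric_on S d \<longleftrightarrow>
     (\<forall>x\<in>S. d x x = 0) \<and> (\<forall>x\<in>S. \<forall>y\<in>S. d x y = d y x) \<and>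
     (\<forall>x\<in>S. \<forall>y\<in>S. \<forall>z\<in>S. d x z \<le> d x y + d y z)"

lemma pseudometric_onI:
  assumes "\<And>x. x \<in> S \<Longrightarrow> d x x = 0"
    and "\<And>x y. x \<in> S \<Longrightarrow> y \<in> S \<Longrightarrow> d x y = d y x"
    and "\<And>x y z. x \<in> S \<Longrightarrow> y \<in> S \<Longrightarrow> z \<in> S \<Longrightarrow> d x z \<le> d x y + d y z"
  shows "pseudometric_on S d"
  using assms unfolding pseudometric_on_def by blast

lemma pseudometric_onD:
  assumes "pseudometric_on S d"
  shows pseudometric_on_refl: "x \<in> S \<Longrightarrow> d x x = 0"
    and pseudometric_on_sym: "x \<in> S \<Longrightarrow> y \<in> S \<Longrightarrow> d x y = d y x"
    and pseudometric_on_triangle: "x \<in> S \<Longrightarrow> y \<in> S \<Longrightarrow> z \<in> S \<Longrightarrow> d x z \<le> d x y + d y z"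
  using assms unfolding pseudometric_on_def by blast+

lemma pseudometric_on_nonneg:
  assumes "pseudometric_on S d" "x \<in> S" "y \<in> S"
  shows "0 \<le> d x y"
  using pseudometric_onD[OF assms(1)] assms(2,3)
  by (smt (verit))

lemma pseudometric_on_diff:
  assumes "pseudometric_on S d" "x \<in> S" "y \<in> S" "z \<in> S"
  shows "\<bar>d x z - d y z\<bar> \<le> d x y"
  using pseudometric_onD[OF assms(1)] assms(2-)
  by (smt (verit))

lemma pseudometric_on_pullback:
  assumes "pseudometric_on S d" "\<And>x. x \<in> T \<Longrightarrow> f x \<in> S"
  shows "pseudometric_on T (\<lambda>x y. d (f x) (f y))"
  using assms unfolding pseudometric_on_def by simp

lemma pseudometric_on_min:
  assumes "pseudometric_on S d" "0 \<le> R"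
  shows "pseudometric_on S (\<lambda>x y. min R (d x y))"
proof (rule pseudometric_onI)
  fix x y z assume "x \<in> S" "y \<in> S" "z \<in> S"
  then show "min R (d x z) \<le> min R (d x y) + min R (d y z)"
    using pseudometric_on_triangle[OF assms(1), of x y z] pseudometric_on_nonneg[OF assms(1)] assms(2)
    by (smt (verit))
qed (use pseudometric_onD[OF assms(1)] assms(2) in auto)

lemma pseudometric_on_convex:
  assumes "pseudometric_on S d" "pseudometric_on S d'" "0 \<le> a" "0 \<le> b"
  shows "pseudometric_on S (\<lambda>x y. a * d x y + b * d' x y)"
proof (rule pseudometric_onI)
  fix x y z assume *: "x \<in> S" "y \<in> S" "z \<in> S"
  have "a * d x z \<le> a * (d x y + d y z)" "b * d' x z \<le> b * (d' x y + d' y z)"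
    using pseudometric_on_triangle[OF assms(1) *] pseudometric_on_triangle[OF assms(2) *] assms(3,4)
    by (auto intro!: mult_left_mono)
  then show "a * d x z + b * d' x z \<le> a * d x y + b * d' x y + (a * d y z + b * d' y z)"
    by (simp add: algebra_simps)
next
  fix x y assume *: "x \<in> S" "y \<in> S"
  then show "a * d x y + b * d' x y = a * d y x + b * d' y x"
    using pseudometric_on_sym[OF assms(1) *] pseudometric_on_sym[OF assms(2) *] by simp
qed (use pseudometric_on_refl[OF assms(1)] pseudometric_on_refl[OF assms(2)] in auto)

text \<open>
  The two spaces are joined by bridges of length \<open>r\<close>, one between \<open>u\<close> and \<open>v\<close> for every pair
  \<open>(u, v) \<in> E\<close>, and points of different spaces are compared by the shortest path that crosses
  one bridge.
\<close>

fun glue ::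
    "('a \<times> 'b) set \<Rightarrow> real \<Rightarrow> ('a \<Rightarrow> 'a \<Rightarrow> real) \<Rightarrow> ('b \<Rightarrow> 'b \<Rightarrow> real) \<Rightarrow> 'a + 'b \<Rightarrow> 'a + 'b \<Rightarrow> real"
  where
  "glue E r d d' (Inl x) (Inl x') = d x x'"
| "glue E r d d' (Inr y) (Inr y') = d' y y'"
| "glue E r d d' (Inl x) (Inr y) = (INF (u, v)\<in>E. d x u + r + d' v y)"
| "glue E r d d' (Inr y) (Inl x) = (INF (u, v)\<in>E. d x u + r + d' v y)"

locale gluing =
  fixes X :: "'a set" and Y :: "'b set" and d d' r E
  assumes d: "pseudometric_on X d" and d': "pseudometric_on Y d'"
    and E: "E \<noteq> {}" "E \<subseteq> X \<times> Y" and r: "0 \<le> r"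
    and compat: "\<And>u v u' v'. (u, v) \<in> E \<Longrightarrow> (u', v') \<in> E \<Longrightarrow> \<bar>d u u' - d' v v'\<bar> \<le> 2 * r"
begin

lemma cross_le:
  assumes "x \<in> X" "y \<in> Y" "(u, v) \<in> E"
  shows "glue E r d d' (Inl x) (Inr y) \<le> d x u + r + d' v y"
proof -
  have "0 \<le> d x u + r + d' v y" if "(u, v) \<in> E" for u v
    using that E r assms pseudometric_on_nonneg[OF d, of x u] pseudometric_on_nonneg[OF d', of v y]
    by auto
  then have "bdd_below ((\<lambda>(u, v). d x u + r + d' v y) ` E)"
    by (auto intro!: bdd_belowI[of _ 0])
  then show ?thesis
    using cINF_lower[of "\<lambda>(u, v). d x u + r + d' v y" E "(u, v)"] assms(3) by simp
qed

lemma le_cross: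
  assumes "\<And>u v. (u, v) \<in> E \<Longrightarrow> c \<le> d x u + r + d' v y"
  shows "c \<le> glue E r d d' (Inl x) (Inr y)"
  using assms E(1) by (auto intro!: cINF_greatest)

lemma cross_commute: "glue E r d d' (Inr y) (Inl x) = glue E r d d' (Inl x) (Inr y)"
  by simp

text \<open>
  Leaving one of the spaces over a bridge and coming back over another is never a short cut: the
  return trip has length \<open>d' v v' + 2 * r\<close> at least, and the compatibility assumption says that
  this is no less than the distance of the two bridge heads. Hence both given metrics survive the
  gluing unchanged.
\<close>

lemma pseudometric_on_glue: "pseudometric_on (X <+> Y) (glue E r d d')"
proof (rule pseudometric_onI)
  fix p assume "p \<in> X <+> Y"
  then show "glue E r d d' p p = 0"
    using pseudometric_on_refl[OF d] pseudometric_on_refl[OF d'] by auto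
next
  fix p q assume "p \<in> X <+> Y" "q \<in> X <+> Y"
  then show "glue E r d d' p q = glue E r d d' q p"
    using pseudometric_on_sym[OF d] pseudometric_on_sym[OF d'] by auto
next
  let ?g = "glue E r d d'"
  note td = pseudometric_on_triangle[OF d] and td' = pseudometric_on_triangle[OF d']
  note sd = pseudometric_on_sym[OF d] and sd' = pseudometric_on_sym[OF d']
  have EX: "u \<in> X" "v \<in> Y" if "(u, v) \<in> E" for u v using that E by auto
  have llr: "?g (Inl x) (Inr y) \<le> d x x' + ?g (Inl x') (Inr y)"
    if *: "x \<in> X" "x' \<in> X" "y \<in> Y" for x x' y
  proof -
    have "?g (Inl x) (Inr y) - d x x' \<le> ?g (Inl x') (Inr y)"
    proof (rule le_cross)
      fix u v assume uv: "(u, v) \<in> E"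
      show "?g (Inl x) (Inr y) - d x x' \<le> d x' u + r + d' v y"
        using cross_le[OF *(1,3) uv] td[OF *(1,2) EX(1)[OF uv]] by linarith
    qed
    then show ?thesis by linarith
  qed
  have lrr: "?g (Inl x) (Inr y) \<le> ?g (Inl x) (Inr y') + d' y' y"
    if *: "x \<in> X" "y \<in> Y" "y' \<in> Y" for x y y'
  proof -
    have "?g (Inl x) (Inr y) - d' y' y \<le> ?g (Inl x) (Inr y')"
    proof (rule le_cross)
      fix u v assume uv: "(u, v) \<in> E"
      show "?g (Inl x) (Inr y) - d' y' y \<le> d x u + r + d' v y'"
        using cross_le[OF *(1,2) uv] td'[OF EX(2)[OF uv] *(3,2)] by linarith
    qed
    then show ?thesis by linarith
  qed
  have lrl: "d x x' \<le> ?g (Inl x) (Inr y) + ?g (Inl x') (Inr y)"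
    if *: "x \<in> X" "x' \<in> X" "y \<in> Y" for x x' y
  proof -
    have "d x x' - ?g (Inl x) (Inr y) \<le> ?g (Inl x') (Inr y)"
    proof (rule le_cross)
      fix u v assume uv: "(u, v) \<in> E"
      have "d x x' - (d x' u + r + d' v y) \<le> ?g (Inl x) (Inr y)"
      proof (rule le_cross)
        fix u' v' assume uv': "(u', v') \<in> E"
        note m = EX[OF uv] EX[OF uv']
        have "d x x' \<le> d x u' + (d u' u + d u x')"
          using td[of x u' x'] td[of u' u x'] * m by fastforce
        moreover have "d u' u \<le> d' v' v + 2 * r" using compat[OF uv' uv] by linarith
        moreover have "d' v' v \<le> d' v' y + d' v y"
          using td'[of v' y v] sd'[of v y] * m by fastforce
        ultimately show "d x x' - (d x' u + r + d' v y) \<le> d x u' + r + d' v' y"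
          using sd[of u x'] * m by fastforce
      qed
      then show "d x x' - ?g (Inl x) (Inr y) \<le> d x' u + r + d' v y" by linarith
    qed
    then show ?thesis by linarith
  qed
  have rlr: "d' y y' \<le> ?g (Inl x) (Inr y) + ?g (Inl x) (Inr y')"
    if *: "x \<in> X" "y \<in> Y" "y' \<in> Y" for x y y'
  proof -
    have "d' y y' - ?g (Inl x) (Inr y) \<le> ?g (Inl x) (Inr y')"
    proof (rule le_cross)
      fix u v assume uv: "(u, v) \<in> E"
      have "d' y y' - (d x u + r + d' v y') \<le> ?g (Inl x) (Inr y)"
      proof (rule le_cross)
        fix u' v' assume uv': "(u', v') \<in> E"
        note m = EX[OF uv] EX[OF uv']
        have "d' y y' \<le> d' y v' + (d' v' v + d' v y')"
          using td'[of y v' y'] td'[of v' v y'] * m by fastforce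
        moreover have "d' v' v \<le> d u' u + 2 * r" using compat[OF uv' uv] by linarith
        moreover have "d u' u \<le> d x u' + d x u"
          using td[of u' x u] sd[of u' x] * m by fastforce
        ultimately show "d' y y' - (d x u + r + d' v y') \<le> d x u' + r + d' v' y"
          using sd'[of y v'] * m by fastforce
      qed
      then show "d' y y' - ?g (Inl x) (Inr y) \<le> d x u + r + d' v y'" by linarith
    qed
    then show ?thesis by linarith
  qed
  fix p q s assume pqs: "p \<in> X <+> Y" "q \<in> X <+> Y" "s \<in> X <+> Y"
  show "?g p s \<le> ?g p q + ?g q s"
  proof (cases p; cases q; cases s)
    fix x x' x'' assume "p = Inl x" "q = Inl x'" "s = Inl x''"
    then show ?thesis using td pqs by auto
  next
    fix x x' y assume "p = Inl x" "q = Inl x'" "s = Inr y"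
    then show ?thesis using llr[of x x' y] pqs by auto
  next
    fix x x' y assume "p = Inl x" "q = Inr y" "s = Inl x'"
    then show ?thesis using lrl[of x x' y] pqs by auto
  next
    fix x y' y assume "p = Inl x" "q = Inr y'" "s = Inr y"
    then show ?thesis using lrr[of x y y'] pqs by auto
  next
    fix x x' y assume "p = Inr y" "q = Inl x" "s = Inl x'"
    then show ?thesis using llr[of x' x y] sd[of x x'] pqs by auto
  next
    fix x y' y assume "p = Inr y" "q = Inl x" "s = Inr y'"
    then show ?thesis using rlr[of x y y'] pqs by auto
  next
    fix x y' y assume "p = Inr y" "q = Inr y'" "s = Inl x"
    then show ?thesis using lrr[of x y y'] sd'[of y' y] pqs by auto
  next
    fix y y' y'' assume "p = Inr y" "q = Inr y'" "s = Inr y''"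
    then show ?thesis using td' pqs by auto
  qed
qed

end

text \<open>
  The distance of \<open>x\<close> and \<open>y\<close> is the uniform distance of the functions \<open>f x\<close> and \<open>f y\<close> on \<open>S\<close>; for
  \<open>f = d\<close> a metric on \<open>S\<close> this is the Kuratowski embedding, and functions that are not of this
  form play the role of new points.
\<close>

definition sup_dist :: "'s set \<Rightarrow> ('a \<Rightarrow> 's \<Rightarrow> real) \<Rightarrow> 'a \<Rightarrow> 'a \<Rightarrow> real" where
  "sup_dist S f x y = (SUP u\<in>S. \<bar>f x u - f y u\<bar>)"

lemma sup_dist_upper:
  assumes "\<And>x u. x \<in> X \<Longrightarrow> u \<in> S \<Longrightarrow> \<bar>f x u\<bar> \<le> B" "x \<in> X" "y \<in> X" "u \<in> S"
  shows "\<bar>f x u - f y u\<bar> \<le> sup_dist S f x y"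
  unfolding sup_dist_def
proof (rule cSUP_upper)
  show "bdd_above ((\<lambda>u. \<bar>f x u - f y u\<bar>) ` S)"
    by (rule bdd_aboveI[of _ "2 * B"]) (use assms(1)[OF assms(2)] assms(1)[OF assms(3)] in fastforce)
qed (use assms in auto)

lemma sup_dist_least:
  assumes "S \<noteq> {}" "\<And>u. u \<in> S \<Longrightarrow> \<bar>f x u - f y u\<bar> \<le> c"
  shows "sup_dist S f x y \<le> c"
  unfolding sup_dist_def using assms by (rule cSUP_least)

lemma pseudometric_on_sup_dist:
  assumes b: "\<And>x u. x \<in> X \<Longrightarrow> u \<in> S \<Longrightarrow> \<bar>f x u\<bar> \<le> B" and S: "S \<noteq> {}"
  shows "pseudometric_on X (sup_dist S f)"
proof (rule pseudometric_onI)
  fix x y z assume *: "x \<in> X" "y \<in> X" "z \<in> X"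
  show "sup_dist S f x z \<le> sup_dist S f x y + sup_dist S f y z"
  proof (rule sup_dist_least[OF S])
    fix u assume u: "u \<in> S"
    show "\<bar>f x u - f z u\<bar> \<le> sup_dist S f x y + sup_dist S f y z"
      using sup_dist_upper[of X S f B x y, OF b _ _ u] sup_dist_upper[of X S f B y z, OF b _ _ u] *
      by fastforce
  qed
qed (use S in \<open>auto simp: sup_dist_def abs_minus_commute\<close>)

text \<open>
  If \<open>f p\<close> is the distance function of the point \<open>x\<close>, the supremum is attained at \<open>x\<close> itself as
  soon as \<open>f q\<close> is a Katetov function, that is, the distance function of a conceivable point.
  So new points get exactly the distances that their functions prescribe.
\<close>

lemma sup_dist_katetov:
  assumes S: "x \<in> S" and b: "\<And>z u. z \<in> X \<Longrightarrow> u \<in> S \<Longrightarrow> \<bar>f z u\<bar> \<le> B" and X: "p \<in> X" "q \<in> X"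
    and p: "f p x = 0" "f q x \<ge> 0"
    and k: "\<And>u. u \<in> S \<Longrightarrow> \<bar>f p u - f q u\<bar> \<le> f q x"
  shows "sup_dist S f p q = f q x"
proof (rule antisym)
  show "sup_dist S f p q \<le> f q x" using S k by (intro sup_dist_least) auto
  show "f q x \<le> sup_dist S f p q"
    using sup_dist_upper[of X S f B p q, OF b X S] p by auto
qed

section \<open>Approximate homogeneity of the Urysohn space\<close>

text \<open>
  Universality speaks about metrics on sets of reals. A countable pseudometric space is brought into
  this form by picking one point \<open>k x\<close> in each class of points at distance 0 and coding it by its
  index in an enumeration.
\<close>

lemma urysohn_countable_embedding:
  fixes d :: "'a \<Rightarrow> 'a \<Rightarrow> real"
  assumes u: "urysohn_universal TYPE('u::polish_space)"
    and Z: "countable Z" and d: "pseudometric_on Z d"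
  shows "\<exists>f :: 'a \<Rightarrow> 'u. \<forall>x\<in>Z. \<forall>y\<in>Z. dist (f x) (f y) = d x y"
proof (cases "Z = {}")
  case True
  then show ?thesis by simp
next
  case False
  define i where "i r = from_nat_into Z (nat \<lfloor>r\<rfloor>)" for r :: real
  define k where "k x = from_nat_into Z (LEAST n. d (from_nat_into Z n) x = 0)" for x
  define M where "M = (\<lambda>x. real (to_nat_on Z x)) ` k ` Z"
  have iZ: "i r \<in> Z" for r unfolding i_def using False by (rule from_nat_into)
  have kZ: "k x \<in> Z" for x unfolding k_def using False by (rule from_nat_into)
  have ik: "i (real (to_nat_on Z (k x))) = k x" for x
    unfolding i_def using Z kZ by simp
  have k0: "d (k x) x = 0" if "x \<in> Z" for x
    unfolding k_def
  proof (rule LeastI_ex)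
    show "\<exists>n. d (from_nat_into Z n) x = 0"
      using that Z pseudometric_on_refl[OF d that] by (metis from_nat_into_to_nat_on)
  qed
  have keq: "k x = k y" if "x \<in> Z" "y \<in> Z" "d x y = 0" for x y
  proof -
    have "d z x = d z y" if "z \<in> Z" for z
      using pseudometric_on_diff[OF d \<open>x \<in> Z\<close> \<open>y \<in> Z\<close> that] \<open>d x y = 0\<close>
        pseudometric_on_sym[OF d] \<open>x \<in> Z\<close> \<open>y \<in> Z\<close> that by simp
    then show ?thesis unfolding k_def using from_nat_into[OF False] by simp
  qed
  have dk: "d (k x) (k y) = d x y" if "x \<in> Z" "y \<in> Z" for x y
    using pseudometric_on_diff[OF d kZ[of x] that(1) kZ[of y]] k0[OF that(1)]
      pseudometric_on_diff[OF d kZ[of y] that(2) that(1)] k0[OF that(2)]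
      pseudometric_on_sym[OF d] that kZ by (smt (verit, best))
  have kk: "k (k x) = k x" if "x \<in> Z" for x
    using keq[OF kZ that k0[OF that]] .
  have "Metric_space M (\<lambda>r s. d (i r) (i s))"
  proof
    show "0 \<le> d (i r) (i s)" for r s using pseudometric_on_nonneg[OF d iZ iZ] .
    show "d (i r) (i s) = d (i s) (i r)" for r s using pseudometric_on_sym[OF d iZ iZ] .
    show "d (i r) (i t) \<le> d (i r) (i s) + d (i s) (i t)" for r s t
      using pseudometric_on_triangle[OF d iZ iZ iZ] .
    fix r s assume "r \<in> M" "s \<in> M"
    then obtain x y where x: "x \<in> Z" "r = real (to_nat_on Z (k x))"
      and y: "y \<in> Z" "s = real (to_nat_on Z (k y))" by (auto simp: M_def)
    show "(d (i r) (i s) = 0) = (r = s)"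
      using x y keq[of x y] dk[of x y] pseudometric_on_refl[OF d x(1)] pseudometric_on_refl[OF d kZ]
      by (metis ik)
  qed
  moreover have "countable M" unfolding M_def using Z by auto
  then have "separable_space (Metric_space.mtopology M (\<lambda>r s. d (i r) (i s)))"
    using calculation by (metis Metric_space.topspace_mtopology closure_of_topspace
        separable_space_def order_refl)
  ultimately obtain f :: "real \<Rightarrow> 'u" where f: "\<forall>r\<in>M. \<forall>s\<in>M. dist (f r) (f s) = d (i r) (i s)"
    using u unfolding urysohn_universal_def by blast
  show ?thesis
  proof (intro exI ballI)
    fix x y assume "x \<in> Z" "y \<in> Z"
    then show "dist (f (real (to_nat_on Z (k x)))) (f (real (to_nat_on Z (k y)))) = d x y"
      using f dk by (simp add: M_def ik)
  qed
qed

lemma Iso_dist: "f \<in> carrier Iso \<Longrightarrow> dist (f x) (f y) = dist x y"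
  by (simp add: Iso_def)

lemma ultrahomogeneous_indexed:
  fixes a b :: "'i \<Rightarrow> 'u::metric_space"
  assumes h: "ultrahomogeneous TYPE('u)" and I: "finite I"
    and ab: "\<And>i k. i \<in> I \<Longrightarrow> k \<in> I \<Longrightarrow> dist (a i) (a k) = dist (b i) (b k)"
  shows "\<exists>g\<in>carrier Iso. \<forall>i\<in>I. g (a i) = b i"
proof -
  define f where "f x = b (SOME i. i \<in> I \<and> a i = x)" for x
  have f: "f (a i) = b i" if "i \<in> I" for i
  proof -
    define k where "k = (SOME k. k \<in> I \<and> a k = a i)"
    have k: "k \<in> I \<and> a k = a i"
      unfolding k_def by (rule someI[of "\<lambda>k. k \<in> I \<and> a k = a i" i]) (use that in simp)
    then have "dist (b k) (b i) = 0" using ab[of k i] that by simp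
    then show ?thesis by (simp add: f_def k_def)
  qed
  have "\<forall>x\<in>a ` I. \<forall>y\<in>a ` I. dist (f x) (f y) = dist x y" using f ab by auto
  with h I have "\<exists>g\<in>carrier Iso. \<forall>x\<in>a ` I. g x = f x"
    unfolding ultrahomogeneous_def by blast
  then show ?thesis using f by auto
qed

text \<open>
  A finite family \<open>p\<close> of points of the Urysohn space that looks like the family \<open>q\<close> in a countable
  space, up to an error \<open>2 * r\<close> in the distances, lies within \<open>r\<close> of a true copy of \<open>q\<close>. Indeed, the
  finite space \<open>p\<close> can be glued to \<open>Z\<close> by bridges of length \<open>r\<close>; the result embeds in the Urysohn
  space, and homogeneity moves the embedded copy of \<open>p\<close> back to \<open>p\<close>. The whole of \<open>Z\<close> is embedded
  here, not only \<open>q\<close>.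
\<close>

lemma urysohn_embedding_near:
  fixes d :: "'a \<Rightarrow> 'a \<Rightarrow> real" and p :: "'i \<Rightarrow> 'u::polish_space"
  assumes u: "is_urysohn_space TYPE('u)"
    and Z: "countable Z" and d: "pseudometric_on Z d"
    and I: "finite I" "I \<noteq> {}" and q: "\<And>i. i \<in> I \<Longrightarrow> q i \<in> Z" and r: "0 \<le> r"
    and compat: "\<And>i k. i \<in> I \<Longrightarrow> k \<in> I \<Longrightarrow> \<bar>dist (p i) (p k) - d (q i) (q k)\<bar> \<le> 2 * r"
  shows "\<exists>f :: 'a \<Rightarrow> 'u. (\<forall>x\<in>Z. \<forall>y\<in>Z. dist (f x) (f y) = d x y) \<and>
    (\<forall>i\<in>I. dist (f (q i)) (p i) \<le> r)"
proof -
  define E where "E = (\<lambda>i. (i, q i)) ` I"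
  note qq = pseudometric_on_refl[OF d q]
  interpret gluing I Z "\<lambda>i k. dist (p i) (p k)" d r E
  proof
    show "pseudometric_on I (\<lambda>i k. dist (p i) (p k))"
      by (rule pseudometric_onI) (auto simp: dist_commute dist_triangle)
  qed (use assms in \<open>auto simp: E_def\<close>)
  let ?g = "glue E r (\<lambda>i k. dist (p i) (p k)) d"
  have "countable (I <+> Z)" using I(1) Z by (simp add: countable_finite)
  then obtain F :: "'i + 'a \<Rightarrow> 'u" where
    F: "\<And>x y. x \<in> I <+> Z \<Longrightarrow> y \<in> I <+> Z \<Longrightarrow> dist (F x) (F y) = ?g x y"
    using urysohn_countable_embedding[OF _ _ pseudometric_on_glue] u
    unfolding is_urysohn_space_def by blast
  have "\<exists>h\<in>carrier Iso. \<forall>i\<in>I. h (F (Inl i)) = p i"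
  proof (rule ultrahomogeneous_indexed[OF _ I(1), of "\<lambda>i. F (Inl i)" p])
    show "ultrahomogeneous TYPE('u)" using u by (simp add: is_urysohn_space_def)
    show "dist (F (Inl i)) (F (Inl k)) = dist (p i) (p k)" if "i \<in> I" "k \<in> I" for i k
      using that by (simp add: F InlI)
  qed
  then obtain h where h: "h \<in> carrier Iso" "\<And>i. i \<in> I \<Longrightarrow> h (F (Inl i)) = p i" by blast
  show ?thesis
  proof (intro exI[of _ "\<lambda>z. h (F (Inr z))"] conjI ballI)
    show "dist (h (F (Inr x))) (h (F (Inr y))) = d x y" if "x \<in> Z" "y \<in> Z" for x y
      using that by (simp add: F InrI Iso_dist[OF h(1)])
    fix i assume i: "i \<in> I"
    have "dist (h (F (Inr (q i)))) (p i) = dist (F (Inl i)) (F (Inr (q i)))"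
      using h(2)[OF i] Iso_dist[OF h(1)] by (metis dist_commute)
    also have "\<dots> = ?g (Inl i) (Inr (q i))" using i q by (intro F) auto
    also have "\<dots> \<le> dist (p i) (p i) + r + d (q i) (q i)"
      using i q by (intro cross_le) (auto simp: E_def)
    also have "\<dots> = r" using qq[OF i] by simp
    finally show "dist (h (F (Inr (q i)))) (p i) \<le> r" .
  qed
qed

text \<open>
  Copy \<open>q\<close> into a position close to \<open>p\<close>, then realize the passage from \<open>q\<close> to its copy by an
  isometry of the whole space.
\<close>

lemma urysohn_approx_homogeneous:
  fixes p q :: "'i \<Rightarrow> 'u::polish_space"
  assumes u: "is_urysohn_space TYPE('u)"
    and I: "finite I" "I \<noteq> {}" and r: "0 \<le> r"
    and compat: "\<And>i k. i \<in> I \<Longrightarrow> k \<in> I \<Longrightarrow> \<bar>dist (p i) (p k) - dist (q i) (q k)\<bar> \<le> 2 * r"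
  shows "\<exists>h\<in>carrier Iso. \<forall>i\<in>I. dist (h (q i)) (p i) \<le> r"
proof -
  have "pseudometric_on (q ` I) dist"
    by (rule pseudometric_onI) (auto simp: dist_commute dist_triangle)
  have "\<exists>f :: 'u \<Rightarrow> 'u. (\<forall>x\<in>q ` I. \<forall>y\<in>q ` I. dist (f x) (f y) = dist x y) \<and>
    (\<forall>i\<in>I. dist (f (q i)) (p i) \<le> r)"
  proof (rule urysohn_embedding_near[OF u])
    show "pseudometric_on (q ` I) dist" by fact
    show "countable (q ` I)" using I(1) by (simp add: countable_finite)
  qed (use I r compat in auto)
  then obtain f :: "'u \<Rightarrow> 'u" where
    f: "\<And>x y. x \<in> q ` I \<Longrightarrow> y \<in> q ` I \<Longrightarrow> dist (f x) (f y) = dist x y"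
    and fp: "\<And>i. i \<in> I \<Longrightarrow> dist (f (q i)) (p i) \<le> r"
    by blast
  have "\<exists>h\<in>carrier Iso. \<forall>i\<in>I. h (q i) = f (q i)"
  proof (rule ultrahomogeneous_indexed[OF _ I(1)])
    show "ultrahomogeneous TYPE('u)" using u by (simp add: is_urysohn_space_def)
    show "dist (q i) (q k) = dist (f (q i)) (f (q k))" if "i \<in> I" "k \<in> I" for i k
      using f that by simp
  qed
  then obtain h where h: "h \<in> carrier Iso" "\<forall>i\<in>I. h (q i) = f (q i)" by blast
  have "dist (h (q i)) (p i) \<le> r" if "i \<in> I" for i
    using fp[OF that] h(2) that by simp
  with h(1) show ?thesis by blast
qed

lemma half_power_tail:
  fixes x :: "nat \<Rightarrow> 'u::metric_space"
  assumes "\<And>k. n \<le> k \<Longrightarrow> dist (x (Suc k)) (x k) \<le> (1/2) ^ k" "n \<le> k"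
  shows "dist (x k) (x n) \<le> 2 * (1/2) ^ n - 2 * (1/2) ^ k"
  using assms(2)
proof (induction k rule: dec_induct)
  case (step k)
  have "dist (x (Suc k)) (x n) \<le> dist (x (Suc k)) (x k) + dist (x k) (x n)"
    by (rule dist_triangle)
  then show ?case using step assms(1)[of k] by simp
qed simp

lemma half_power_limit:
  fixes x :: "nat \<Rightarrow> 'u::complete_space"
  assumes "\<And>k. N \<le> k \<Longrightarrow> dist (x (Suc k)) (x k) \<le> (1/2) ^ k"
  shows "x \<longlonglongrightarrow> lim x" and "\<And>n. N \<le> n \<Longrightarrow> dist (lim x) (x n) \<le> 2 * (1/2) ^ n"
proof -
  have b: "dist (x k) (x n) \<le> 2 * (1/2) ^ n" if "N \<le> n" "n \<le> k" for n k
  proof -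
    have "dist (x k) (x n) \<le> 2 * (1/2) ^ n - 2 * (1/2) ^ k"
      using assms that by (intro half_power_tail) auto
    moreover have "0 \<le> (1/2::real) ^ k" by simp
    ultimately show ?thesis by linarith
  qed
  have "Cauchy x"
  proof (rule metric_CauchyI)
    fix e :: real assume "0 < e"
    then obtain M where M: "(1/2::real) ^ M < e / 4"
      using real_arch_pow_inv[of "e/4" "1/2"] by auto
    define n where "n = max M N"
    have "(1/2::real) ^ n \<le> (1/2) ^ M" by (intro power_decreasing) (auto simp: n_def)
    with M have n: "(1/2::real) ^ n < e / 4" by linarith
    have "dist (x k) (x l) < e" if "n \<le> k" "n \<le> l" for k l
      using dist_triangle2[of "x k" "x l" "x n"] b[of n k] b[of n l] that n n_def by simp
    then show "\<exists>M. \<forall>m\<ge>M. \<forall>n\<ge>M. dist (x m) (x n) < e" by blast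
  qed
  then have "convergent x" by (rule Cauchy_convergent)
  then show L: "x \<longlonglongrightarrow> lim x" by (simp add: convergent_LIMSEQ_iff)
  fix n assume "N \<le> n"
  show "dist (lim x) (x n) \<le> 2 * (1/2) ^ n"
  proof (rule LIMSEQ_le_const2)
    show "(\<lambda>k. dist (x k) (x n)) \<longlonglongrightarrow> dist (lim x) (x n)" by (intro tendsto_intros L)
    show "\<exists>N. \<forall>k\<ge>N. dist (x k) (x n) \<le> 2 * (1/2) ^ n" using b \<open>N \<le> n\<close> by blast
  qed
qed

text \<open>
  This replaces the uniqueness of the Urysohn space: a countable space with the approximate extension
  property has a completion isometric to the Urysohn space. It is a back-and-forth argument in which
  no step is exact. A sequence of isometric embeddings \<open>e n\<close> of the whole of \<open>Z\<close> is constructed,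
  together with growing finite sets \<open>F n\<close> on which consecutive embeddings differ by at most
  \<open>(1/2) ^ n\<close>. To catch a prescribed point \<open>q n\<close>, its distances to the image of \<open>F n\<close> are realized up
  to a small error by some \<open>z \<in> B\<close>, and the next embedding is chosen close to the old one on \<open>F n\<close>
  while it sends \<open>z\<close> close to \<open>q n\<close>. The embeddings converge because the target is complete. The set
  \<open>B\<close> allows the points with dense image to be taken from a given subset of \<open>Z\<close>.
\<close>

lemma urysohn_dense_embedding:
  fixes d :: "'a \<Rightarrow> 'a \<Rightarrow> real"
  assumes u: "is_urysohn_space TYPE('u::polish_space)"
    and Z: "countable Z" "Z \<noteq> {}" and d: "pseudometric_on Z d" and B: "B \<subseteq> Z"
    and ext: "\<And>F f \<epsilon>. finite F \<Longrightarrow> F \<noteq> {} \<Longrightarrow> F \<subseteq> Z \<Longrightarrow> 0 < \<epsilon> \<Longrightarrow>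
        (\<And>x y. x \<in> F \<Longrightarrow> y \<in> F \<Longrightarrow> \<bar>f x - f y\<bar> \<le> d x y \<and> d x y \<le> f x + f y) \<Longrightarrow>
        \<exists>z\<in>B. \<forall>x\<in>F. \<bar>d z x - f x\<bar> < (\<epsilon> :: real)"
  shows "\<exists>e :: 'a \<Rightarrow> 'u. (\<forall>x\<in>Z. \<forall>y\<in>Z. dist (e x) (e y) = d x y) \<and> closure (e ` B) = UNIV"
proof -
  obtain D :: "'u set" where D: "countable D" "\<And>X. open X \<Longrightarrow> X \<noteq> {} \<Longrightarrow> \<exists>x\<in>D. x \<in> X"
    using countable_dense_exists by blast
  \<comment> \<open>every point of \<open>D\<close> occurs infinitely often, hence also at stages with small error\<close>
  define q where "q n = from_nat_into D (snd (prod_decode n))" for n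
  define P where "P = (\<lambda>(e :: 'a \<Rightarrow> 'u, F). finite F \<and> F \<noteq> {} \<and> F \<subseteq> Z \<and>
      (\<forall>x\<in>Z. \<forall>y\<in>Z. dist (e x) (e y) = d x y))"
  define Q where "Q n = (\<lambda>(e :: 'a \<Rightarrow> 'u, F) (e', F'). F \<subseteq> F' \<and> from_nat_into Z n \<in> F' \<and>
      (\<forall>x\<in>F. dist (e' x) (e x) \<le> (1/2) ^ n) \<and> (\<exists>z\<in>F' \<inter> B. dist (e' z) (q n) \<le> (1/2) ^ n))" for n
  have "\<exists>s. \<forall>n. P (s n) \<and> Q n (s n) (s (Suc n))"
  proof (rule dependent_nat_choice)
    obtain z where z: "z \<in> Z" using Z(2) by blast
    obtain e :: "'a \<Rightarrow> 'u" where "\<And>x y. x \<in> Z \<Longrightarrow> y \<in> Z \<Longrightarrow> dist (e x) (e y) = d x y"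
      using urysohn_countable_embedding[OF _ Z(1) d] u unfolding is_urysohn_space_def by blast
    then have "P (e, {z})" using z by (simp add: P_def)
    then show "\<exists>s. P s" ..
  next
    fix s n assume "P s"
    then obtain e F where s: "s = (e, F)" and F: "finite F" "F \<noteq> {}" "F \<subseteq> Z"
      and e: "\<And>x y. x \<in> Z \<Longrightarrow> y \<in> Z \<Longrightarrow> dist (e x) (e y) = d x y"
      by (cases s) (auto simp: P_def)
    have r: "0 < (1/2 :: real) ^ n" by simp
    have "\<exists>z\<in>B. \<forall>x\<in>F. \<bar>d z x - dist (q n) (e x)\<bar> < (1/2) ^ n"
    proof (rule ext[OF F r])
      fix x y assume "x \<in> F" "y \<in> F"
      then have "dist (e x) (e y) = d x y" using e F(3) by blast
      then show "\<bar>dist (q n) (e x) - dist (q n) (e y)\<bar> \<le> d x y \<and> d x y \<le> dist (q n) (e x) + dist (q n) (e y)"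
        by (metis abs_dist_diff_le dist_commute dist_triangle)
    qed
    then obtain z where z: "z \<in> B" "\<And>x. x \<in> F \<Longrightarrow> \<bar>d z x - dist (q n) (e x)\<bar> < (1/2) ^ n"
      by blast
    \<comment> \<open>\<open>None\<close> stands for the new point, which is to be sent near \<open>q n\<close>\<close>
    define I where "I = insert None (Some ` F)"
    define p where "p = case_option (q n) e"
    have "\<exists>e'. (\<forall>x\<in>Z. \<forall>y\<in>Z. dist (e' x :: 'u) (e' y) = d x y) \<and>
        (\<forall>i\<in>I. dist (e' (case_option z (\<lambda>x. x) i)) (p i) \<le> (1/2) ^ n)"
    proof (rule urysohn_embedding_near[OF u Z(1) d, of I "case_option z (\<lambda>x. x)" "(1/2) ^ n" p])
      show "finite I" "I \<noteq> {}" using F(1) by (auto simp: I_def)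
      show "case_option z (\<lambda>x. x) i \<in> Z" if "i \<in> I" for i
        using that z(1) B F(3) by (auto simp: I_def)
      have b: "\<bar>dist (q n) (e x) - d z x\<bar> \<le> 2 * (1/2) ^ n" if "x \<in> F" for x
        using z(2)[OF that] by linarith
      have b': "\<bar>dist (e x) (q n) - d x z\<bar> \<le> 2 * (1/2) ^ n" if "x \<in> F" for x
      proof -
        have "x \<in> Z" "z \<in> Z" using that F(3) z(1) B by auto
        then show ?thesis
          using b[OF that] pseudometric_on_sym[OF d, of x z] by (simp add: dist_commute)
      qed
      have zz: "d z z = 0" using pseudometric_on_refl[OF d] z(1) B by blast
      show "\<bar>dist (p i) (p k) - d (case_option z (\<lambda>x. x) i) (case_option z (\<lambda>x. x) k)\<bar>
          \<le> 2 * (1/2) ^ n" if "i \<in> I" "k \<in> I" for i k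
        using that b b' zz F(3) by (auto simp: I_def p_def e subset_iff)
    qed auto
    then obtain e' where e': "\<And>x y. x \<in> Z \<Longrightarrow> y \<in> Z \<Longrightarrow> dist (e' x :: 'u) (e' y) = d x y"
      and near: "\<And>i. i \<in> I \<Longrightarrow> dist (e' (case_option z (\<lambda>x. x) i)) (p i) \<le> (1/2) ^ n"
      by blast
    define F' where "F' = insert z (insert (from_nat_into Z n) F)"
    have "P (e', F')"
      using F e' z(1) B from_nat_into[OF Z(2)] by (auto simp: P_def F'_def)
    moreover have "Q n (e, F) (e', F')"
      using near[of None] near[of "Some _"] z(1) by (auto simp: Q_def F'_def I_def p_def)
    ultimately show "\<exists>t. P t \<and> Q n s t" unfolding s by blast
  qed
  then obtain s where s: "\<And>n. P (s n)" "\<And>n. Q n (s n) (s (Suc n))" by blast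
  define e where "e n = fst (s n)" for n
  define F where "F n = snd (s n)" for n
  have eF: "s n = (e n, F n)" for n by (simp add: e_def F_def)
  have iso: "dist (e n x) (e n y) = d x y" if "x \<in> Z" "y \<in> Z" for n x y
    using s(1)[of n] that by (simp add: P_def eF)
  have mono: "F n \<subseteq> F k" if "n \<le> k" for n k
    by (rule lift_Suc_mono_le[OF _ that]) (use s(2) in \<open>auto simp: Q_def eF\<close>)
  have step: "dist (e (Suc n) x) (e n x) \<le> (1/2) ^ n" if "x \<in> F N" "N \<le> n" for x n N
    using s(2)[of n] mono[OF that(2)] that(1) by (auto simp: Q_def eF)
  have ex: "\<exists>N. x \<in> F N" if "x \<in> Z" for x
    using s(2)[of "to_nat_on Z x"] that Z(1) by (auto simp: Q_def eF)
  define h where "h x = lim (\<lambda>n. e n x)" for x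
  have hlim: "(\<lambda>n. e n x) \<longlonglongrightarrow> h x" if "x \<in> Z" for x
    using ex[OF that] half_power_limit(1)[of _ "\<lambda>n. e n x"] step unfolding h_def by blast
  have hnear: "dist (h x) (e n x) \<le> 2 * (1/2) ^ n" if "x \<in> F n" for x n
    unfolding h_def
    using half_power_limit(2)[of n "\<lambda>n. e n x" n] step[OF that] by auto
  show ?thesis
  proof (intro exI[of _ h] conjI ballI)
    fix x y assume "x \<in> Z" "y \<in> Z"
    then have "(\<lambda>n. dist (e n x) (e n y)) \<longlonglongrightarrow> dist (h x) (h y)"
      by (intro tendsto_dist hlim)
    then show "dist (h x) (h y) = d x y" using iso \<open>x \<in> Z\<close> \<open>y \<in> Z\<close> by (simp add: LIMSEQ_const_iff)
  next
    have "y \<in> closure (h ` B)" for y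
      unfolding closure_approachable
    proof (intro allI impI)
      fix \<epsilon> :: real assume \<epsilon>: "0 < \<epsilon>"
      obtain x where x: "x \<in> D" "x \<in> ball y (\<epsilon>/2)"
        using D(2)[of "ball y (\<epsilon>/2)"] \<epsilon> by auto
      obtain M where M: "(1/2::real) ^ M < \<epsilon> / 8"
        using real_arch_pow_inv[of "\<epsilon>/8" "1/2"] \<epsilon> by auto
      define n where "n = prod_encode (M, to_nat_on D x)"
      have "M \<le> n" by (simp add: n_def le_prod_encode_1)
      then have "(1/2::real) ^ n \<le> (1/2) ^ M" by (intro power_decreasing) auto
      with M have n: "(1/2::real) ^ n < \<epsilon> / 8" by linarith
      have qn: "q n = x" using x(1) D(1) by (simp add: q_def n_def)
      obtain z where z: "z \<in> F (Suc n)" "z \<in> B" "dist (e (Suc n) z) (q n) \<le> (1/2) ^ n"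
        using s(2)[of n] by (auto simp: Q_def eF)
      have "dist (h z) (e (Suc n) z) \<le> (1/2) ^ n" using hnear[OF z(1)] by simp
      then have "dist (h z) x \<le> 2 * (1/2) ^ n"
        using dist_triangle[of "h z" x "e (Suc n) z"] z(3) unfolding qn by linarith
      then have "dist (h z) y < \<epsilon>"
      proof -
        have "dist x y < \<epsilon> / 2" using x(2) by (simp add: dist_commute)
        with dist_triangle[of "h z" y x] n \<open>dist (h z) x \<le> _\<close> \<epsilon> show ?thesis by linarith
      qed
      then show "\<exists>w\<in>h ` B. dist w y < \<epsilon>" using z(2) by blast
    qed
    then show "closure (h ` B) = UNIV" by blast
  qed
qed

section \<open>Extending isometries from a dense set\<close>

text \<open>
  The prescription \<open>e x \<mapsto> e (s x)\<close> is single valued on the image of \<open>e\<close> because it preserves distances,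
  even if \<open>e\<close> is not injective; uniform continuity extends it to the closure.
\<close>

lemma isometry_extension:
  fixes e :: "'a \<Rightarrow> 'u::complete_space"
  assumes dense: "closure (e ` Z) = UNIV"
    and sZ: "\<And>x. x \<in> Z \<Longrightarrow> s x \<in> Z"
    and s: "\<And>x y. x \<in> Z \<Longrightarrow> y \<in> Z \<Longrightarrow> dist (e (s x)) (e (s y)) = dist (e x) (e y)"
  shows "\<exists>a. (\<forall>x y. dist (a x) (a y) = dist x y) \<and> (\<forall>x\<in>Z. a (e x) = e (s x))"
proof -
  define f where "f u = e (s (SOME x. x \<in> Z \<and> e x = u))" for u
  have f: "f (e x) = e (s x)" if "x \<in> Z" for x
  proof -
    define y where "y = (SOME y. y \<in> Z \<and> e y = e x)"
    have y: "y \<in> Z \<and> e y = e x"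
      unfolding y_def by (rule someI[of "\<lambda>y. y \<in> Z \<and> e y = e x" x]) (use that in simp)
    then have "dist (e (s y)) (e (s x)) = 0" using s[of y x] that by simp
    then show ?thesis by (simp add: f_def y_def)
  qed
  have iso: "dist (f u) (f v) = dist u v" if "u \<in> e ` Z" "v \<in> e ` Z" for u v
    using that f s by auto
  then have "uniformly_continuous_on (e ` Z) f"
    unfolding uniformly_continuous_on_def by metis
  then obtain a where a: "uniformly_continuous_on (closure (e ` Z)) a"
    and af: "\<And>u. u \<in> e ` Z \<Longrightarrow> f u = a u"
    using uniformly_continuous_on_extension_on_closure by metis
  have c: "isCont a u" for u
    using uniformly_continuous_imp_continuous[OF a] dense by (simp add: continuous_on_eq_continuous_at)
  show ?thesis
  proof (intro exI[of _ a] conjI allI ballI)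
    fix u v
    obtain x y where x: "\<And>n. x n \<in> e ` Z" "x \<longlonglongrightarrow> u" and y: "\<And>n. y n \<in> e ` Z" "y \<longlonglongrightarrow> v"
      using dense closure_sequential[of _ "e ` Z"] by (metis UNIV_I)
    have "(\<lambda>n. dist (a (x n)) (a (y n))) \<longlonglongrightarrow> dist (a u) (a v)"
      using c x(2) y(2) by (intro tendsto_dist) (auto intro: isCont_tendsto_compose)
    moreover have "(\<lambda>n. dist (a (x n)) (a (y n))) = (\<lambda>n. dist (x n) (y n))"
      using iso x(1) y(1) af by metis
    moreover have "(\<lambda>n. dist (x n) (y n)) \<longlonglongrightarrow> dist u v" using x y by (intro tendsto_dist)
    ultimately show "dist (a u) (a v) = dist u v" by (metis LIMSEQ_unique)
  next
    fix x assume "x \<in> Z"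
    then show "a (e x) = e (s x)" using af f by (metis imageI)
  qed
qed

lemma isometries_eq_if_eq_on_dense:
  fixes a b :: "'u::metric_space \<Rightarrow> 'v::metric_space"
  assumes dense: "closure S = UNIV"
    and a: "\<And>x y. dist (a x) (a y) = dist x y" and b: "\<And>x y. dist (b x) (b y) = dist x y"
    and eq: "\<And>x. x \<in> S \<Longrightarrow> a x = b x"
  shows "a = b"
proof
  fix u
  have "dist (a u) (b u) \<le> \<epsilon>" if \<epsilon>: "0 < \<epsilon>" for \<epsilon>
  proof -
    have "u \<in> closure S" using dense by simp
    then obtain x where x: "x \<in> S" "dist x u < \<epsilon> / 2"
      using \<epsilon> half_gt_zero unfolding closure_approachable by blast
    show ?thesis
      using dist_triangle[of "a u" "b u" "a x"] a[of u x] b[of x u] eq[OF x(1)] x(2)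
      by (simp add: dist_commute)
  qed
  then have "dist (a u) (b u) \<le> 0" by (meson field_le_epsilon add_0 dense_ge)
  then show "a u = b u" by simp
qed

section \<open>Invariant pseudometrics on free actions\<close>

text \<open>
  Orbits of base points \<open>z\<^sub>0, z\<^sub>1, \<dots>\<close> under an isometric action are described by the distances between
  the translates of these points. So the pair \<open>(g, i)\<close> below stands for \<open>g\<close> applied to \<open>z\<^sub>i\<close>, and an
  action on a separable space amounts to a pseudometric on such pairs that is invariant under left
  translation.
\<close>

locale countable_group = group +
  assumes countable_carrier: "countable (carrier G)"
begin

abbreviation points :: "('a \<times> nat) set" where
  "points \<equiv> carrier G \<times> UNIV"

definition invariant :: "('a \<times> nat \<Rightarrow> 'a \<times> nat \<Rightarrow> real) \<Rightarrow> bool" where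
  "invariant \<sigma> \<longleftrightarrow> pseudometric_on points \<sigma> \<and>
     (\<forall>g\<in>carrier G. \<forall>h\<in>carrier G. \<forall>k\<in>carrier G. \<forall>i j. \<sigma> (g \<otimes> h, i) (g \<otimes> k, j) = \<sigma> (h, i) (k, j))"

definition bounded_invariant :: "('a \<times> nat \<Rightarrow> 'a \<times> nat \<Rightarrow> real) \<Rightarrow> bool" where
  "bounded_invariant \<sigma> \<longleftrightarrow> invariant \<sigma> \<and> (\<exists>B. \<forall>x\<in>points. \<forall>y\<in>points. \<sigma> x y \<le> B)"

text \<open>
  A finite stage of the construction is a bounded invariant pseudometric \<open>\<sigma>\<close> together with a number
  \<open>N\<close>: only the orbits with index below \<open>N\<close> have been decided, and the values of \<open>\<sigma>\<close> on the others
  may still change. A later stage must agree with an earlier one on the orbits that the earlier one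
  has decided.
\<close>

definition agree :: "nat \<Rightarrow> ('a \<times> nat \<Rightarrow> 'a \<times> nat \<Rightarrow> real) \<Rightarrow> ('a \<times> nat \<Rightarrow> 'a \<times> nat \<Rightarrow> real) \<Rightarrow> bool"
  where "agree N \<sigma> \<sigma>' \<longleftrightarrow>
    (\<forall>x\<in>carrier G \<times> {..<N}. \<forall>y\<in>carrier G \<times> {..<N}. \<sigma>' x y = \<sigma> x y)"

lemma invariant_pseudometric: "invariant \<sigma> \<Longrightarrow> pseudometric_on points \<sigma>"
  by (simp add: invariant_def)

lemma invariant_translate:
  "invariant \<sigma> \<Longrightarrow> g \<in> carrier G \<Longrightarrow> h \<in> carrier G \<Longrightarrow> k \<in> carrier G \<Longrightarrow>
    \<sigma> (g \<otimes> h, i) (g \<otimes> k, j) = \<sigma> (h, i) (k, j)"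
  by (simp add: invariant_def)

lemma bounded_invariant_pseudometric: "bounded_invariant \<sigma> \<Longrightarrow> pseudometric_on points \<sigma>"
  by (simp add: bounded_invariant_def invariant_def)

lemma bounded_invariant_min:
  assumes "invariant \<sigma>" "0 \<le> R"
  shows "bounded_invariant (\<lambda>x y. min R (\<sigma> x y))"
  using pseudometric_on_min[OF _ assms(2), of points \<sigma>] assms(1)
  unfolding bounded_invariant_def invariant_def by (auto intro: exI[of _ R])

lemma bounded_invariant_convex:
  assumes "bounded_invariant \<sigma>" "bounded_invariant \<tau>" "0 \<le> a" "0 \<le> b"
  shows "bounded_invariant (\<lambda>x y. a * \<sigma> x y + b * \<tau> x y)"
proof -
  obtain A B where "\<forall>x\<in>points. \<forall>y\<in>points. \<sigma> x y \<le> A" "\<forall>x\<in>points. \<forall>y\<in>points. \<tau> x y \<le> B"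
    using assms unfolding bounded_invariant_def by blast
  then have "\<forall>x\<in>points. \<forall>y\<in>points. a * \<sigma> x y + b * \<tau> x y \<le> a * A + b * B"
    using assms(3,4) by (intro ballI add_mono mult_left_mono) auto
  then show ?thesis
    using pseudometric_on_convex[OF _ _ assms(3,4), of points \<sigma> \<tau>] assms(1,2)
    unfolding bounded_invariant_def invariant_def by auto
qed

lemma agreeD:
  assumes "agree N \<sigma> \<sigma>'" "x \<in> carrier G \<times> {..<N}" "y \<in> carrier G \<times> {..<N}"
  shows "\<sigma>' x y = \<sigma> x y"
  using assms unfolding agree_def by blast

lemma agree_refl: "agree N \<sigma> \<sigma>"
  by (simp add: agree_def)

lemma agree_trans:
  assumes "agree N \<sigma> \<sigma>'" "agree N' \<sigma>' \<sigma>''" "N \<le> N'"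
  shows "agree N \<sigma> \<sigma>''"
  unfolding agree_def
proof (intro ballI)
  fix x y assume *: "x \<in> carrier G \<times> {..<N}" "y \<in> carrier G \<times> {..<N}"
  with assms(3) have "x \<in> carrier G \<times> {..<N'}" "y \<in> carrier G \<times> {..<N'}" by auto
  with agreeD[OF assms(2)] agreeD[OF assms(1) *] show "\<sigma>'' x y = \<sigma> x y" by simp
qed

lemma mult_inv_cancel: "g \<in> carrier G \<Longrightarrow> h \<in> carrier G \<Longrightarrow> g \<otimes> (inv g \<otimes> h) = h"
  by (simp add: m_assoc[symmetric])

lemma translate_image_points:
  assumes "g \<in> carrier G"
  shows "(\<lambda>(h, i). (g \<otimes> h, i)) ` points = points"
proof (intro equalityI subsetI)
  fix x assume "x \<in> points"
  then obtain h i where x: "x = (h, i)" "h \<in> carrier G" by auto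
  then show "x \<in> (\<lambda>(h, i). (g \<otimes> h, i)) ` points"
    using assms by (intro image_eqI[of _ _ "(inv g \<otimes> h, i)"]) (simp_all add: mult_inv_cancel)
qed (use assms in auto)

text \<open>
  New orbits are added to a stage by gluing: indices below \<open>N\<close> keep their meaning and \<open>N + j\<close> becomes
  the \<open>j\<close>-th orbit of the space \<open>\<tau>\<close>. Translation invariance survives since the set \<open>E\<close> of bridges
  is invariant.
\<close>

lemma stage_gluing:
  assumes \<sigma>: "bounded_invariant \<sigma>" and \<tau>: "bounded_invariant \<tau>"
    and E: "E \<noteq> {}" "E \<subseteq> points \<times> points"
    and inv_E: "\<And>g h i k j. g \<in> carrier G \<Longrightarrow> ((h, i), (k, j)) \<in> E \<Longrightarrow> ((g \<otimes> h, i), (g \<otimes> k, j)) \<in> E"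
    and r: "0 \<le> r"
    and compat: "\<And>u v u' v'. (u, v) \<in> E \<Longrightarrow> (u', v') \<in> E \<Longrightarrow> \<bar>\<sigma> u u' - \<tau> v v'\<bar> \<le> 2 * r"
  shows "\<exists>\<sigma>'. bounded_invariant \<sigma>' \<and> agree N \<sigma> \<sigma>' \<and>
    (\<forall>g\<in>carrier G. \<forall>h\<in>carrier G. \<forall>i j. \<sigma>' (g, N + i) (h, N + j) = \<tau> (g, i) (h, j)) \<and>
    (\<forall>g i h j. ((g, i), (h, j)) \<in> E \<and> i < N \<longrightarrow> \<sigma>' (g, i) (h, N + j) \<le> r)"
proof -
  interpret gluing points points \<sigma> \<tau> r E
    by standard (use assms bounded_invariant_pseudometric in auto)
  define \<Phi> where "\<Phi> = (\<lambda>(g :: 'a, i). if i < N then Inl (g, i) else Inr (g, i - N))"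
  define \<sigma>' where "\<sigma>' x y = glue E r \<sigma> \<tau> (\<Phi> x) (\<Phi> y)" for x y
  note trans = invariant_translate[of \<sigma>] invariant_translate[of \<tau>]
  have inv\<sigma>: "invariant \<sigma>" "invariant \<tau>" using \<sigma> \<tau> by (auto simp: bounded_invariant_def)
  have \<Phi>: "\<Phi> x \<in> points <+> points" if "x \<in> points" for x
    using that by (auto simp: \<Phi>_def)
  have ps: "pseudometric_on points \<sigma>'"
    unfolding \<sigma>'_def using \<Phi> by (rule pseudometric_on_pullback[OF pseudometric_on_glue])
  have cross_inv: "glue E r \<sigma> \<tau> (Inl (g \<otimes> h, i)) (Inr (g \<otimes> k, j)) = glue E r \<sigma> \<tau> (Inl (h, i)) (Inr (k, j))"
    if g: "g \<in> carrier G" and hk: "h \<in> carrier G" "k \<in> carrier G" for g h k i j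
  proof -
    \<comment> \<open>translation by \<open>g\<close> permutes the bridges, so it only reorders the infimum\<close>
    let ?t = "\<lambda>((h, i), (k, j)). ((g \<otimes> h, i), (g \<otimes> k, j))"
    have "E = ?t ` E"
    proof (intro equalityI subsetI)
      fix e assume e: "e \<in> E"
      obtain a b c d where abcd: "e = ((a, b), (c, d))" by (cases e) auto
      have "((inv g \<otimes> a, b), (inv g \<otimes> c, d)) \<in> E" using inv_E[of "inv g"] e g abcd by auto
      moreover have "e = ?t ((inv g \<otimes> a, b), (inv g \<otimes> c, d))"
        using e E(2) g abcd by (auto simp: mult_inv_cancel)
      ultimately show "e \<in> ?t ` E" by (intro image_eqI[of _ ?t])
    qed (use inv_E[OF g] in auto)
    then have "(INF (u, v)\<in>E. \<sigma> (g \<otimes> h, i) u + r + \<tau> v (g \<otimes> k, j)) =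
        (INF (u, v)\<in>?t ` E. \<sigma> (g \<otimes> h, i) u + r + \<tau> v (g \<otimes> k, j))"
      by simp
    also have "\<dots> = (INF (u, v)\<in>E. \<sigma> (h, i) u + r + \<tau> v (k, j))"
      unfolding image_image
      by (rule INF_cong) (use E(2) trans inv\<sigma> g hk in auto)
    finally show ?thesis by simp
  qed
  have inv: "invariant \<sigma>'"
    unfolding invariant_def
  proof (intro conjI ps ballI allI)
    fix g h k i j assume *: "g \<in> carrier G" "h \<in> carrier G" "k \<in> carrier G"
    show "\<sigma>' (g \<otimes> h, i) (g \<otimes> k, j) = \<sigma>' (h, i) (k, j)"
      using cross_inv[OF *, of i "j - N"] cross_inv[OF *(1,3,2), of j "i - N"] trans inv\<sigma> *
      by (auto simp: \<sigma>'_def \<Phi>_def cross_commute simp del: glue.simps(3,4))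
  qed
  obtain A B where A: "\<And>x y. x \<in> points \<Longrightarrow> y \<in> points \<Longrightarrow> \<sigma> x y \<le> A"
    and B: "\<And>x y. x \<in> points \<Longrightarrow> y \<in> points \<Longrightarrow> \<tau> x y \<le> B"
    using \<sigma> \<tau> unfolding bounded_invariant_def by meson
  obtain u v where uv: "(u, v) \<in> E" using E(1) by auto
  have uvp: "u \<in> points" "v \<in> points" using uv E(2) by auto
  have "0 \<le> A" "0 \<le> B"
    using A[OF uvp(1,1)] B[OF uvp(2,2)] pseudometric_on_refl[OF d uvp(1)] pseudometric_on_refl[OF d' uvp(2)]
    by simp_all
  have c: "glue E r \<sigma> \<tau> (Inl x) (Inr y) \<le> A + r + B" if "x \<in> points" "y \<in> points" for x y
    using cross_le[OF that uv] A[OF that(1) uvp(1)] B[OF uvp(2) that(2)] by linarith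
  have "\<sigma>' x y \<le> A + r + B" if "x \<in> points" "y \<in> points" for x y
  proof -
    have "\<sigma> x y \<le> A + r + B" if "x \<in> points" "y \<in> points" for x y
      using A[OF that] \<open>0 \<le> B\<close> r by linarith
    moreover have "\<tau> x y \<le> A + r + B" if "x \<in> points" "y \<in> points" for x y
      using B[OF that] \<open>0 \<le> A\<close> r by linarith
    ultimately show ?thesis using that c
      by (auto simp: \<sigma>'_def \<Phi>_def cross_commute simp del: glue.simps(3,4))
  qed
  then have bd: "bounded_invariant \<sigma>'" using inv unfolding bounded_invariant_def by blast
  have le: "\<sigma>' (g, i) (h, N + j) \<le> r" if "((g, i), (h, j)) \<in> E" "i < N" for g i h j
  proof -
    have m: "(g, i) \<in> points" "(h, j) \<in> points" using that E(2) by auto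
    have "\<sigma>' (g, i) (h, N + j) = glue E r \<sigma> \<tau> (Inl (g, i)) (Inr (h, j))"
      using that(2) by (simp add: \<sigma>'_def \<Phi>_def)
    also have "\<dots> \<le> \<sigma> (g, i) (g, i) + r + \<tau> (h, j) (h, j)"
      by (rule cross_le[OF m that(1)])
    also have "\<dots> = r" using pseudometric_on_refl[OF d m(1)] pseudometric_on_refl[OF d' m(2)] by simp
    finally show ?thesis .
  qed
  show ?thesis
    by (intro exI[of _ \<sigma>'] conjI bd) (use le in \<open>auto simp: agree_def \<sigma>'_def \<Phi>_def\<close>)
qed

section \<open>A generic invariant pseudometric\<close>

text \<open>
  A task is a finite set \<open>L\<close> of requirements ``the distance of \<open>x\<close> and \<open>y\<close> lies strictly between \<open>lo\<close>
  and \<open>hi\<close>''. The orbit indices that occur in \<open>L\<close> are variables, which \<open>s\<close> assigns to orbits decided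
  before \<open>N\<close>; only the variables below \<open>m\<close> name fixed orbits. Strict rational bounds leave countably
  many tasks.
\<close>

definition realizes :: "nat \<Rightarrow> (('a \<times> nat) \<times> ('a \<times> nat) \<times> real \<times> real) set \<Rightarrow>
    ('a \<times> nat \<Rightarrow> 'a \<times> nat \<Rightarrow> real) \<Rightarrow> nat \<Rightarrow> bool" where
  "realizes m L \<sigma> N \<longleftrightarrow> (\<exists>s. (\<forall>j<m. s j = j) \<and>
     (\<forall>(x, y, lo, hi)\<in>L. s (snd x) < N \<and> s (snd y) < N \<and>
        lo < \<sigma> (apsnd s x) (apsnd s y) \<and> \<sigma> (apsnd s x) (apsnd s y) < hi))"

definition tasks :: "(nat \<times> (('a \<times> nat) \<times> ('a \<times> nat) \<times> real \<times> real) set) set" where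
  "tasks = UNIV \<times> {L. finite L \<and> L \<subseteq> points \<times> points \<times> \<rat> \<times> \<rat>}"

lemma countable_tasks: "countable tasks"
  unfolding tasks_def
  by (intro countable_SIGMA countable_Collect_finite_subset countable_carrier countable_rat) auto

lemma realizes_agree:
  assumes "agree N \<sigma> \<sigma>'" "N \<le> N'" "realizes m L \<sigma> N" "L \<subseteq> points \<times> points \<times> UNIV"
  shows "realizes m L \<sigma>' N'"
proof -
  obtain s where s: "\<forall>j<m. s j = j" "\<forall>(x, y, lo, hi)\<in>L. s (snd x) < N \<and> s (snd y) < N \<and>
        lo < \<sigma> (apsnd s x) (apsnd s y) \<and> \<sigma> (apsnd s x) (apsnd s y) < hi"
    using assms(3) unfolding realizes_def by blast
  have "s (snd x) < N' \<and> s (snd y) < N' \<and>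
        lo < \<sigma>' (apsnd s x) (apsnd s y) \<and> \<sigma>' (apsnd s x) (apsnd s y) < hi" if "(x, y, lo, hi) \<in> L" for x y lo hi
  proof -
    have *: "s (snd x) < N" "s (snd y) < N"
        "lo < \<sigma> (apsnd s x) (apsnd s y)" "\<sigma> (apsnd s x) (apsnd s y) < hi"
      using s(2) that by auto
    moreover have "\<sigma>' (apsnd s x) (apsnd s y) = \<sigma> (apsnd s x) (apsnd s y)"
      using assms(1,4) * that unfolding agree_def by (cases x; cases y) auto
    ultimately show ?thesis using assms(2) by simp
  qed
  then show ?thesis unfolding realizes_def using s(1) by (intro exI[of _ s]) auto
qed

definition extension_realizes :: "nat \<times> (('a \<times> nat) \<times> ('a \<times> nat) \<times> real \<times> real) set \<Rightarrow>
    ('a \<times> nat \<Rightarrow> 'a \<times> nat \<Rightarrow> real) \<Rightarrow> nat \<Rightarrow> bool" where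
  "extension_realizes t \<sigma> N \<longleftrightarrow>
    (\<exists>\<sigma>' N'. bounded_invariant \<sigma>' \<and> N \<le> N' \<and> agree N \<sigma> \<sigma>' \<and> realizes (fst t) (snd t) \<sigma>' N')"

text \<open>
  Every task that remains achievable at all sufficiently late stages has been achieved. Moreover,
  finitely many orbits always have finite diameter; this is what later allows two actions to be
  joined by finitely many small steps.
\<close>

definition generic :: "('a \<times> nat \<Rightarrow> 'a \<times> nat \<Rightarrow> real) \<Rightarrow> bool" where
  "generic \<rho> \<longleftrightarrow> invariant \<rho> \<and>
     (\<forall>N. \<exists>B. \<forall>x\<in>carrier G \<times> {..<N}. \<forall>y\<in>carrier G \<times> {..<N}. \<rho> x y \<le> B) \<and>
     (\<forall>t\<in>tasks. (\<exists>N\<^sub>0. \<forall>\<sigma> N. N\<^sub>0 \<le> N \<longrightarrow> bounded_invariant \<sigma> \<longrightarrow> agree N \<rho> \<sigma> \<longrightarrow>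
          extension_realizes t \<sigma> N) \<longrightarrow> (\<exists>N. realizes (fst t) (snd t) \<rho> N))"

text \<open>
  Build an increasing sequence of stages and attend to the \<open>n\<close>-th task when the stage number \<open>n\<close> is
  reached: if some extension achieves it, move to such an extension. Once is enough: if a task is
  achievable from late stages it is achievable from stage \<open>n\<close> too, because an extension of a late
  stage extends stage \<open>n\<close>, and what has been achieved stays achieved.
\<close>

lemma exists_generic: "\<exists>\<rho>. generic \<rho>"
proof -
  define T where "T = from_nat_into tasks"
  have ne: "tasks \<noteq> {}" unfolding tasks_def by auto
  define P where "P n = (\<lambda>(\<sigma>, N). bounded_invariant \<sigma> \<and> n \<le> (N :: nat))" for n :: nat
  define Q where "Q n = (\<lambda>(\<sigma>, N) (\<sigma>', N'). N \<le> N' \<and> agree N \<sigma> \<sigma>' \<and>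
      (extension_realizes (T n) \<sigma> N \<longrightarrow> realizes (fst (T n)) (snd (T n)) \<sigma>' N'))" for n
  have "\<exists>S. \<forall>n. P n (S n) \<and> Q n (S n) (S (Suc n))"
  proof (rule dependent_nat_choice)
    have "bounded_invariant (\<lambda>x y. 0)"
      unfolding bounded_invariant_def invariant_def pseudometric_on_def by auto
    then have "P 0 (\<lambda>x y. 0, 0)" by (simp add: P_def)
    then show "\<exists>p. P 0 p" ..
  next
    fix p n assume "P n p"
    then obtain \<sigma> N where p: "p = (\<sigma>, N)" "bounded_invariant \<sigma>" "n \<le> N" by (cases p) (auto simp: P_def)
    show "\<exists>q. P (Suc n) q \<and> Q n p q"
    proof (cases "extension_realizes (T n) \<sigma> N")
      case True
      then obtain \<sigma>' N' where *: "bounded_invariant \<sigma>'" "N \<le> N'" "agree N \<sigma> \<sigma>'"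
        "realizes (fst (T n)) (snd (T n)) \<sigma>' N'"
        unfolding extension_realizes_def by blast
      have "realizes (fst (T n)) (snd (T n)) \<sigma>' (Suc N')"
      proof (rule realizes_agree[OF agree_refl _ *(4)])
        have "T n \<in> tasks" unfolding T_def by (rule from_nat_into[OF ne])
        then show "snd (T n) \<subseteq> points \<times> points \<times> UNIV" by (auto simp: tasks_def)
      qed simp
      then show ?thesis using p * by (intro exI[of _ "(\<sigma>', Suc N')"]) (auto simp: P_def Q_def)
    next
      case False
      then show ?thesis using p
        by (intro exI[of _ "(\<sigma>, Suc N)"]) (auto simp: P_def Q_def agree_refl)
    qed
  qed
  then obtain S where S: "\<And>n. P n (S n)" "\<And>n. Q n (S n) (S (Suc n))" by blast
  define \<sigma> where "\<sigma> n = fst (S n)" for n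
  define N where "N n = snd (S n)" for n
  have Seq: "S n = (\<sigma> n, N n)" for n by (simp add: \<sigma>_def N_def)
  have bd: "bounded_invariant (\<sigma> n)" and Nn: "n \<le> N n" for n
    using S(1)[of n] by (auto simp: P_def Seq)
  have ag: "N n \<le> N k \<and> agree (N n) (\<sigma> n) (\<sigma> k)" if "n \<le> k" for n k
    using that
  proof (induction k rule: dec_induct)
    case base
    then show ?case by (simp add: agree_def)
  next
    case (step k)
    then show ?case using S(2)[of k] agree_trans[of "N n" "\<sigma> n" "\<sigma> k" "N k" "\<sigma> (Suc k)"]
      by (auto simp: Q_def Seq)
  qed
  \<comment> \<open>stage \<open>n\<close> has decided at least \<open>n\<close> orbits, so at this stage both \<open>x\<close> and \<open>y\<close> are settled\<close>
  define \<rho> where "\<rho> x y = \<sigma> (Suc (max (snd x) (snd y))) x y" for x y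
  have \<rho>: "\<rho> x y = \<sigma> n x y" if "x \<in> carrier G \<times> {..<N n}" "y \<in> carrier G \<times> {..<N n}" for x y n
  proof -
    let ?k = "Suc (max (snd x) (snd y))"
    have k: "x \<in> carrier G \<times> {..<N ?k}" "y \<in> carrier G \<times> {..<N ?k}"
      using that Nn[of ?k] by auto
    show ?thesis
    proof (cases "n \<le> ?k")
      case True
      then show ?thesis using ag[OF True] agreeD[OF _ that] by (simp add: \<rho>_def)
    next
      case False
      then have "?k \<le> n" by simp
      from ag[OF this] have "agree (N ?k) (\<sigma> ?k) (\<sigma> n)" by blast
      from agreeD[OF this k] show ?thesis by (simp add: \<rho>_def)
    qed
  qed
  have \<rho>': "\<rho> x y = \<sigma> n x y" if "x \<in> points" "y \<in> points" "snd x < n" "snd y < n" for x y n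
    using that Nn[of n] by (intro \<rho>) auto
  have "pseudometric_on points \<rho>"
  proof (rule pseudometric_onI)
    fix x assume x: "x \<in> points"
    then show "\<rho> x x = 0"
      using pseudometric_on_refl[OF bounded_invariant_pseudometric[OF bd] x] \<rho>'[OF x x lessI lessI] by simp
  next
    fix x y assume xy: "x \<in> points" "y \<in> points"
    show "\<rho> x y = \<rho> y x"
      using pseudometric_on_sym[OF bounded_invariant_pseudometric[OF bd] xy] by (simp add: \<rho>_def max.commute)
  next
    fix x y z assume xyz: "x \<in> points" "y \<in> points" "z \<in> points"
    let ?n = "Suc (max (snd x) (max (snd y) (snd z)))"
    have "\<rho> x y = \<sigma> ?n x y" "\<rho> y z = \<sigma> ?n y z" "\<rho> x z = \<sigma> ?n x z"
      by (rule \<rho>'; use xyz in simp)+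
    then show "\<rho> x z \<le> \<rho> x y + \<rho> y z"
      using pseudometric_on_triangle[OF bounded_invariant_pseudometric[OF bd] xyz] by simp
  qed
  then have inv: "invariant \<rho>"
    unfolding invariant_def
  proof (intro conjI ballI allI)
    fix g h k i j assume "g \<in> carrier G" "h \<in> carrier G" "k \<in> carrier G"
    then show "\<rho> (g \<otimes> h, i) (g \<otimes> k, j) = \<rho> (h, i) (k, j)"
      using bd unfolding \<rho>_def bounded_invariant_def by (simp add: invariant_translate)
  qed
  have "\<exists>B. \<forall>x\<in>carrier G \<times> {..<M}. \<forall>y\<in>carrier G \<times> {..<M}. \<rho> x y \<le> B" for M
  proof -
    obtain B where "\<forall>x\<in>points. \<forall>y\<in>points. \<sigma> M x y \<le> B"
      using bd[of M] unfolding bounded_invariant_def by blast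
    then show ?thesis using \<rho>'[of _ _ M] by (intro exI[of _ B]) auto
  qed
  moreover have "\<exists>M. realizes (fst t) (snd t) \<rho> M"
    if t: "t \<in> tasks" and *: "\<forall>\<tau> M. M\<^sub>0 \<le> M \<longrightarrow> bounded_invariant \<tau> \<longrightarrow> agree M \<rho> \<tau> \<longrightarrow> extension_realizes t \<tau> M"
    for t M\<^sub>0
  proof -
    obtain n where n: "T n = t" using from_nat_into_to_nat_on[OF countable_tasks t] unfolding T_def by blast
    define k where "k = max n M\<^sub>0"
    have "M\<^sub>0 \<le> N k" using Nn[of k] by (simp add: k_def)
    moreover have "agree (N k) \<rho> (\<sigma> k)" unfolding agree_def using \<rho>[of _ k] by simp
    ultimately obtain \<tau> M where \<tau>: "bounded_invariant \<tau>" "N k \<le> M" "agree (N k) (\<sigma> k) \<tau>"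
        "realizes (fst t) (snd t) \<tau> M"
      using * bd unfolding extension_realizes_def by blast
    have nk: "N n \<le> N k" "agree (N n) (\<sigma> n) (\<sigma> k)" using ag[of n k] by (auto simp: k_def)
    have "extension_realizes (T n) (\<sigma> n) (N n)"
      unfolding extension_realizes_def n
      using \<tau>(1,4) agree_trans[OF nk(2) \<tau>(3) nk(1)] le_trans[OF nk(1) \<tau>(2)] by blast
    then have "realizes (fst t) (snd t) (\<sigma> (Suc n)) (N (Suc n))"
      using S(2)[of n] by (auto simp: Q_def Seq n)
    moreover have "agree (N (Suc n)) (\<sigma> (Suc n)) \<rho>"
      unfolding agree_def using \<rho>[of _ "Suc n"] by simp
    moreover have "snd t \<subseteq> points \<times> points \<times> UNIV" using t unfolding tasks_def by auto
    ultimately show ?thesis using realizes_agree by blast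
  qed
  ultimately show ?thesis unfolding generic_def using inv by blast
qed

lemma generic_invariant: "generic \<rho> \<Longrightarrow> invariant \<rho>"
  by (simp add: generic_def)

text \<open>
  The form in which genericity is applied: requirements with real bounds, which every late stage can
  meet non-strictly, are met by \<open>\<rho>\<close> up to \<open>\<epsilon>\<close>. The gap \<open>\<epsilon>\<close> leaves room for rational bounds that do not
  depend on the stage.
\<close>

lemma generic_realizes:
  assumes gen: "generic \<rho>" and A: "finite A" "A \<subseteq> points \<times> points" and \<epsilon>: "0 < \<epsilon>"
    and ext: "\<And>\<sigma> N. N\<^sub>0 \<le> N \<Longrightarrow> bounded_invariant \<sigma> \<Longrightarrow> agree N \<rho> \<sigma> \<Longrightarrow>
      \<exists>\<sigma>' N' s. bounded_invariant \<sigma>' \<and> N \<le> N' \<and> agree N \<sigma> \<sigma>' \<and> (\<forall>j<m. s j = j) \<and>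
        (\<forall>(x, y)\<in>A. s (snd x) < N' \<and> s (snd y) < N' \<and>
          lo x y \<le> \<sigma>' (apsnd s x) (apsnd s y) \<and> \<sigma>' (apsnd s x) (apsnd s y) \<le> hi x y)"
  shows "\<exists>s. (\<forall>j<m. s j = j) \<and> (\<forall>(x, y)\<in>A. lo x y - \<epsilon> < \<rho> (apsnd s x) (apsnd s y) \<and>
      \<rho> (apsnd s x) (apsnd s y) < hi x y + \<epsilon>)"
proof -
  have "\<forall>x y. \<exists>q\<in>\<rat>. lo x y - \<epsilon> < q \<and> q < lo x y" using \<epsilon> by (auto intro: Rats_dense_in_real)
  then obtain lo' where lo': "\<And>x y. lo' x y \<in> \<rat> \<and> lo x y - \<epsilon> < lo' x y \<and> lo' x y < lo x y" by metis
  have "\<forall>x y. \<exists>q\<in>\<rat>. hi x y < q \<and> q < hi x y + \<epsilon>" using \<epsilon> by (auto intro: Rats_dense_in_real)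
  then obtain hi' where hi': "\<And>x y. hi' x y \<in> \<rat> \<and> hi x y < hi' x y \<and> hi' x y < hi x y + \<epsilon>" by metis
  define L where "L = (\<lambda>(x, y). (x, y, lo' x y, hi' x y)) ` A"
  have t: "(m, L) \<in> tasks" using A lo' hi' by (auto simp: tasks_def L_def)
  have "extension_realizes (m, L) \<sigma> N" if *: "N\<^sub>0 \<le> N" "bounded_invariant \<sigma>" "agree N \<rho> \<sigma>" for \<sigma> N
  proof -
    obtain \<sigma>' N' s where 1: "bounded_invariant \<sigma>'" "N \<le> N'" "agree N \<sigma> \<sigma>'" and s: "\<forall>j<m. s j = j"
      "\<forall>(x, y)\<in>A. s (snd x) < N' \<and> s (snd y) < N' \<and>
          lo x y \<le> \<sigma>' (apsnd s x) (apsnd s y) \<and> \<sigma>' (apsnd s x) (apsnd s y) \<le> hi x y"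
      using ext[OF *] by auto
    have "realizes m L \<sigma>' N'"
      unfolding realizes_def L_def
    proof (intro exI[of _ s] conjI s(1), clarsimp)
      fix a i b j assume "((a, i), (b, j)) \<in> A"
      then show "s i < N' \<and> s j < N' \<and> lo' (a, i) (b, j) < \<sigma>' (a, s i) (b, s j) \<and>
          \<sigma>' (a, s i) (b, s j) < hi' (a, i) (b, j)"
        using s(2) lo'[of "(a, i)" "(b, j)"] hi'[of "(a, i)" "(b, j)"] by fastforce
    qed
    then show ?thesis using 1 unfolding extension_realizes_def by auto
  qed
  then obtain N where "realizes m L \<rho> N"
    using gen t unfolding generic_def by (metis fst_conv snd_conv)
  then obtain s where s: "\<forall>j<m. s j = j" "\<forall>(x, y, lo, hi)\<in>L. s (snd x) < N \<and> s (snd y) < N \<and>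
      lo < \<rho> (apsnd s x) (apsnd s y) \<and> \<rho> (apsnd s x) (apsnd s y) < hi"
    unfolding realizes_def by blast
  have "lo x y - \<epsilon> < \<rho> (apsnd s x) (apsnd s y) \<and> \<rho> (apsnd s x) (apsnd s y) < hi x y + \<epsilon>"
    if "(x, y) \<in> A" for x y
  proof -
    have "(x, y, lo' x y, hi' x y) \<in> L" using that by (auto simp: L_def)
    with s(2) have "lo' x y < \<rho> (apsnd s x) (apsnd s y)" "\<rho> (apsnd s x) (apsnd s y) < hi' x y" by auto
    then show ?thesis using lo'[of x y] hi'[of x y] by linarith
  qed
  then show ?thesis using s(1) by blast
qed

end

section \<open>Extension and path properties of a generic pseudometric\<close>

context countable_group
begin

text \<open>
  This is the approximate extension property that characterizes dense subsets of the Urysohn space.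
  A prescription \<open>f\<close> of distances to finitely many points extends to a Katetov function \<open>k\<close> on the
  whole stage, and a new orbit is added whose point \<open>g\<close> has the translated function
  \<open>k (g\<inverse> \<cdot> _)\<close> as its distance function; distances within the new orbit are uniform distances of
  these functions. All of this is bounded because the stage is. The new point is a base point, so
  base points alone will turn out to be dense.
\<close>

lemma generic_extension:
  assumes gen: "generic \<rho>" and F: "finite F" "F \<noteq> {}" "F \<subseteq> points" and \<epsilon>: "0 < (\<epsilon> :: real)"
    and f: "\<And>x y. x \<in> F \<Longrightarrow> y \<in> F \<Longrightarrow> \<bar>f x - f y\<bar> \<le> \<rho> x y \<and> \<rho> x y \<le> f x + f y"
  shows "\<exists>j. \<forall>x\<in>F. \<bar>\<rho> (\<one>, j) x - f x\<bar> < \<epsilon>"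
proof -
  define m where "m = Suc (Max (snd ` F))"
  have mF: "snd x < m" if "x \<in> F" for x
    using F(1) that by (simp add: m_def less_Suc_eq_le)
  have "\<exists>s. (\<forall>j<m. s j = j) \<and> (\<forall>(x, y)\<in>F \<times> {(\<one>, m)}. f x - \<epsilon> < \<rho> (apsnd s x) (apsnd s y) \<and>
      \<rho> (apsnd s x) (apsnd s y) < f x + \<epsilon>)"
  proof (rule generic_realizes[OF gen, of _ _ m])
    show "finite (F \<times> {(\<one>, m)})" "F \<times> {(\<one>, m)} \<subseteq> points \<times> points" using F by auto
    fix \<sigma> N assume N: "m \<le> N" and \<sigma>: "bounded_invariant \<sigma>" and ag: "agree N \<rho> \<sigma>"
    note ps = bounded_invariant_pseudometric[OF \<sigma>]
    have inv\<sigma>: "invariant \<sigma>" using \<sigma> by (simp add: bounded_invariant_def)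
    obtain B where B: "\<And>x y. x \<in> points \<Longrightarrow> y \<in> points \<Longrightarrow> \<sigma> x y \<le> B"
      using \<sigma> unfolding bounded_invariant_def by meson
    have FN: "x \<in> carrier G \<times> {..<N}" if "x \<in> F" for x
      using F(3) mF[OF that] N that by (cases x) auto
    have \<sigma>\<rho>: "\<sigma> x y = \<rho> x y" if "x \<in> F" "y \<in> F" for x y
      by (rule agreeD[OF ag FN[OF that(1)] FN[OF that(2)]])
    \<comment> \<open>the largest extension of \<open>f\<close> that is 1-Lipschitz\<close>
    define k where "k u = Min ((\<lambda>x. f x + \<sigma> x u) ` F)" for u
    have k_le: "k u \<le> f x + \<sigma> x u" if "x \<in> F" for x u
      unfolding k_def using F(1) that by auto
    have k_ex: "\<exists>x\<in>F. k u = f x + \<sigma> x u" for u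
    proof -
      have "k u \<in> (\<lambda>x. f x + \<sigma> x u) ` F" unfolding k_def using F by (intro Min_in) auto
      then show ?thesis by blast
    qed
    have kf: "k x = f x" if x: "x \<in> F" for x
    proof -
      obtain y where y: "y \<in> F" "k x = f y + \<sigma> y x" using k_ex by blast
      have "k x \<le> f x" using k_le[OF x, of x] pseudometric_on_refl[OF ps] x F(3) by auto
      moreover have "f x \<le> k x" using f[OF y(1) x] \<sigma>\<rho>[OF y(1) x] y(2) by linarith
      ultimately show ?thesis by simp
    qed
    have k1: "k u \<le> k v + \<sigma> u v" if "u \<in> points" "v \<in> points" for u v
    proof -
      obtain y where y: "y \<in> F" "k v = f y + \<sigma> y v" using k_ex by blast
      then have yp: "y \<in> points" using F(3) by blast
      show ?thesis
        using k_le[OF y(1), of u] y(2) pseudometric_on_triangle[OF ps yp that(2,1)]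
          pseudometric_on_sym[OF ps that] by linarith
    qed
    have k2: "\<sigma> u v \<le> k u + k v" if uv: "u \<in> points" "v \<in> points" for u v
    proof -
      obtain x where x: "x \<in> F" "k u = f x + \<sigma> x u" using k_ex by blast
      obtain y where y: "y \<in> F" "k v = f y + \<sigma> y v" using k_ex by blast
      have p: "x \<in> points" "y \<in> points" using x y F(3) by auto
      have "\<sigma> u v \<le> \<sigma> u x + (\<sigma> x y + \<sigma> y v)"
        using pseudometric_on_triangle[OF ps uv(1) p(1) uv(2)]
          pseudometric_on_triangle[OF ps p uv(2)] by linarith
      then show ?thesis
        using f[OF x(1) y(1)] \<sigma>\<rho>[OF x(1) y(1)] x(2) y(2) pseudometric_on_sym[OF ps uv(1) p(1)]
        by linarith
    qed
    have k0: "0 \<le> k u" if "u \<in> points" for u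
      using k2[OF that that] pseudometric_on_refl[OF ps that] by linarith
    obtain x\<^sub>0 where x\<^sub>0: "x\<^sub>0 \<in> F" using F(2) by blast
    define C where "C = max B (f x\<^sub>0 + B)"
    have kC: "k u \<le> C" if "u \<in> points" for u
      using k_le[OF x\<^sub>0, of u] B[of x\<^sub>0 u] x\<^sub>0 F(3) that unfolding C_def by fastforce
    have \<sigma>C: "\<sigma> u v \<le> C" if "u \<in> points" "v \<in> points" for u v
      using B[OF that] unfolding C_def by linarith
    define \<phi> where "\<phi> x u = (if snd x < N then \<sigma> x u else k (inv (fst x) \<otimes> fst u, snd u))"
      for x u :: "'a \<times> nat"
    have \<phi>b: "\<bar>\<phi> x u\<bar> \<le> C" if "x \<in> points" "u \<in> points" for x u
    proof -
      have w: "(inv (fst x) \<otimes> fst u, snd u) \<in> points" using that by auto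
      have "0 \<le> \<phi> x u" using k0[OF w] pseudometric_on_nonneg[OF ps that] by (simp add: \<phi>_def)
      moreover have "\<phi> x u \<le> C" using kC[OF w] \<sigma>C[OF that] by (simp add: \<phi>_def)
      ultimately show ?thesis by simp
    qed
    have pne: "points \<noteq> {}" by auto
    define \<sigma>' where "\<sigma>' = sup_dist points \<phi>"
    have \<sigma>'_kat: "\<sigma>' x y = \<phi> y x"
      if x: "x \<in> points" "snd x < N" and y: "y \<in> points"
        and kat: "\<And>u. u \<in> points \<Longrightarrow> \<bar>\<phi> x u - \<phi> y u\<bar> \<le> \<phi> y x" for x y
      unfolding \<sigma>'_def
    proof (rule sup_dist_katetov[where X = points and B = C])
      show "\<phi> x x = 0" using x pseudometric_on_refl[OF ps x(1)] by (simp add: \<phi>_def)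
      show "0 \<le> \<phi> y x" using kat[OF x(1)] by linarith
    qed (use x y \<phi>b kat in auto)
    have bi: "bounded_invariant \<sigma>'"
      unfolding bounded_invariant_def invariant_def
    proof (intro conjI ballI allI)
      show "pseudometric_on points \<sigma>'" unfolding \<sigma>'_def by (rule pseudometric_on_sup_dist[OF \<phi>b pne])
      have "\<sigma>' x y \<le> 2 * C" if "x \<in> points" "y \<in> points" for x y
        unfolding \<sigma>'_def
      proof (rule sup_dist_least[OF pne])
        fix u assume u: "u \<in> points"
        show "\<bar>\<phi> x u - \<phi> y u\<bar> \<le> 2 * C" using \<phi>b[OF that(1) u] \<phi>b[OF that(2) u] by linarith
      qed
      then show "\<exists>B. \<forall>x\<in>points. \<forall>y\<in>points. \<sigma>' x y \<le> B" by blast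
      fix g h h' i i' assume g: "g \<in> carrier G" "h \<in> carrier G" "h' \<in> carrier G"
      have \<phi>t: "\<phi> (g \<otimes> a, b) (g \<otimes> c, d) = \<phi> (a, b) (c, d)" if "a \<in> carrier G" "c \<in> carrier G" for a b c d
      proof -
        have "inv g \<otimes> (g \<otimes> c) = c" using g(1) that by (simp add: m_assoc[symmetric])
        then have "inv (g \<otimes> a) \<otimes> (g \<otimes> c) = inv a \<otimes> c"
          using g(1) that by (simp add: inv_mult_group m_assoc)
        then show ?thesis using g(1) that invariant_translate[OF inv\<sigma>] by (simp add: \<phi>_def)
      qed
      have "\<sigma>' (g \<otimes> h, i) (g \<otimes> h', i') =
          (SUP u\<in>(\<lambda>(h, i). (g \<otimes> h, i)) ` points. \<bar>\<phi> (g \<otimes> h, i) u - \<phi> (g \<otimes> h', i') u\<bar>)"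
        unfolding translate_image_points[OF g(1)] by (simp add: \<sigma>'_def sup_dist_def)
      also have "\<dots> = (SUP u\<in>points. \<bar>\<phi> (h, i) u - \<phi> (h', i') u\<bar>)"
        unfolding image_image by (rule SUP_cong) (use \<phi>t g in auto)
      also have "\<dots> = \<sigma>' (h, i) (h', i')" by (simp add: \<sigma>'_def sup_dist_def)
      finally show "\<sigma>' (g \<otimes> h, i) (g \<otimes> h', i') = \<sigma>' (h, i) (h', i')" .
    qed
    have ag': "agree N \<sigma> \<sigma>'"
      unfolding agree_def
    proof (intro ballI)
      fix x y assume xy: "x \<in> carrier G \<times> {..<N}" "y \<in> carrier G \<times> {..<N}"
      then have xy': "x \<in> points" "y \<in> points" "snd x < N" "snd y < N" by auto
      have "\<sigma>' x y = \<phi> y x"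
      proof (rule \<sigma>'_kat)
        fix u assume u: "u \<in> points"
        show "\<bar>\<phi> x u - \<phi> y u\<bar> \<le> \<phi> y x"
          using pseudometric_on_diff[OF ps xy'(1,2) u] pseudometric_on_sym[OF ps xy'(1,2)] xy'
          by (simp add: \<phi>_def)
      qed (use xy' in auto)
      then show "\<sigma>' x y = \<sigma> x y" using xy' pseudometric_on_sym[OF ps xy'(1,2)] by (simp add: \<phi>_def)
    qed
    have new: "\<sigma>' x (\<one>, N) = f x" if x: "x \<in> F" for x
    proof -
      have x': "x \<in> points" "snd x < N" using x F(3) mF[OF x] N by auto
      have \<phi>1: "\<phi> (\<one>, N) u = k u" if "u \<in> points" for u using that by (auto simp: \<phi>_def)
      have "\<sigma>' x (\<one>, N) = \<phi> (\<one>, N) x"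
      proof (rule \<sigma>'_kat)
        fix u assume u: "u \<in> points"
        have "\<bar>\<sigma> x u - k u\<bar> \<le> k x"
          using k1[OF u x'(1)] k2[OF x'(1) u] k1[OF x'(1) u] pseudometric_on_sym[OF ps x'(1) u] by linarith
        then show "\<bar>\<phi> x u - \<phi> (\<one>, N) u\<bar> \<le> \<phi> (\<one>, N) x"
          using \<phi>1[OF u] \<phi>1[OF x'(1)] x'(2) by (simp add: \<phi>_def)
      qed (use x' in auto)
      then show ?thesis using \<phi>1[OF x'(1)] kf[OF x] by simp
    qed
    define s where "s j = (if j < m then j else N)" for j
    have "s (snd x) < Suc N \<and> s (snd y) < Suc N \<and>
          f x \<le> \<sigma>' (apsnd s x) (apsnd s y) \<and> \<sigma>' (apsnd s x) (apsnd s y) \<le> f x"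
      if "(x, y) \<in> F \<times> {(\<one>, m)}" for x y
    proof -
      have "apsnd s x = x" "apsnd s y = (\<one>, N)" using that mF by (cases x; auto simp: s_def)+
      then show ?thesis using new that N by (auto simp: s_def)
    qed
    then show "\<exists>\<sigma>' N' s. bounded_invariant \<sigma>' \<and> N \<le> N' \<and> agree N \<sigma> \<sigma>' \<and> (\<forall>j<m. s j = j) \<and>
        (\<forall>(x, y)\<in>F \<times> {(\<one>, m)}. s (snd x) < N' \<and> s (snd y) < N' \<and>
          f x \<le> \<sigma>' (apsnd s x) (apsnd s y) \<and> \<sigma>' (apsnd s x) (apsnd s y) \<le> f x)"
      using bi ag' by (intro exI[of _ \<sigma>'] exI[of _ "Suc N"] exI[of _ s]) (auto simp: s_def)
  qed (use \<epsilon> in auto)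
  then obtain s where s: "\<forall>j<m. s j = j"
    "\<forall>(x, y)\<in>F \<times> {(\<one>, m)}. f x - \<epsilon> < \<rho> (apsnd s x) (apsnd s y) \<and> \<rho> (apsnd s x) (apsnd s y) < f x + \<epsilon>"
    by blast
  have "\<bar>\<rho> (\<one>, s m) x - f x\<bar> < \<epsilon>" if x: "x \<in> F" for x
  proof -
    have "apsnd s x = x" using s(1) mF[OF x] by (cases x) auto
    then have "f x - \<epsilon> < \<rho> x (\<one>, s m)" "\<rho> x (\<one>, s m) < f x + \<epsilon>" using s(2) x by fastforce+
    moreover have "\<rho> x (\<one>, s m) = \<rho> (\<one>, s m) x"
      using x F(3) by (intro pseudometric_on_sym[OF invariant_pseudometric[OF generic_invariant[OF gen]]]) auto
    ultimately show ?thesis by linarith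
  qed
  then show ?thesis by blast
qed

text \<open>
  A finite sequence of invariant pseudometrics in which neighbours differ by at most \<open>2 * r\<close> on the
  first \<open>M\<close> orbits is realized inside a single stage: each term lives on its own block of \<open>M\<close>
  orbits, starting at index \<open>c i\<close>, and corresponding orbits of consecutive blocks are \<open>r\<close>-close. The
  blocks are attached one after the other, each glued to its predecessor only.
\<close>

lemma glued_path:
  assumes \<theta>: "\<forall>l\<le>K. bounded_invariant (\<theta> l)" and M: "0 < M" "M \<le> N" and r: "0 \<le> r"
    and step: "\<forall>l<K. \<forall>x\<in>carrier G \<times> {..<M}. \<forall>y\<in>carrier G \<times> {..<M}.
        \<bar>\<theta> l x y - \<theta> (Suc l) x y\<bar> \<le> 2 * r"
    and l: "l \<le> K"
  shows "\<exists>\<sigma> N' c. bounded_invariant \<sigma> \<and> N \<le> N' \<and> agree N (\<theta> 0) \<sigma> \<and> c 0 = 0 \<and>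
    (\<forall>i\<le>l. c i + M \<le> N' \<and> (\<forall>g\<in>carrier G. \<forall>h\<in>carrier G. \<forall>j<M. \<forall>k<M.
        \<sigma> (g, c i + j) (h, c i + k) = \<theta> i (g, j) (h, k))) \<and>
    (\<forall>i<l. \<forall>j<M. \<sigma> (\<one>, c i + j) (\<one>, c (Suc i) + j) \<le> (r :: real))"
  using l
proof (induction l)
  case 0
  show ?case
    using \<theta> M agree_refl by (intro exI[of _ "\<theta> 0"] exI[of _ N] exI[of _ "\<lambda>_. 0"]) auto
next
  case (Suc l)
  then obtain \<sigma> N' c where \<sigma>: "bounded_invariant \<sigma>" "N \<le> N'" "agree N (\<theta> 0) \<sigma>" "c 0 = 0"
    and c: "\<And>i. i \<le> l \<Longrightarrow> c i + M \<le> N'"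
    and slice: "\<And>i g h j k. i \<le> l \<Longrightarrow> g \<in> carrier G \<Longrightarrow> h \<in> carrier G \<Longrightarrow> j < M \<Longrightarrow> k < M \<Longrightarrow>
        \<sigma> (g, c i + j) (h, c i + k) = \<theta> i (g, j) (h, k)"
    and adj: "\<And>i j. i < l \<Longrightarrow> j < M \<Longrightarrow> \<sigma> (\<one>, c i + j) (\<one>, c (Suc i) + j) \<le> r"
    by (metis Suc_leD)
  define E where "E = (\<lambda>(g, j). ((g, c l + j), (g, j))) ` (carrier G \<times> {..<M})"
  have "\<exists>\<sigma>'. bounded_invariant \<sigma>' \<and> agree N' \<sigma> \<sigma>' \<and>
    (\<forall>g\<in>carrier G. \<forall>h\<in>carrier G. \<forall>i j. \<sigma>' (g, N' + i) (h, N' + j) = \<theta> (Suc l) (g, i) (h, j)) \<and>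
    (\<forall>g i h j. ((g, i), (h, j)) \<in> E \<and> i < N' \<longrightarrow> \<sigma>' (g, i) (h, N' + j) \<le> r)"
  proof (rule stage_gluing[OF \<sigma>(1) \<theta>[rule_format, OF Suc.prems] _ _ _ r])
    show "E \<noteq> {}" using M(1) by (auto simp: E_def)
    show "E \<subseteq> points \<times> points" by (auto simp: E_def)
    show "((g \<otimes> h, i), (g \<otimes> k, j)) \<in> E" if "g \<in> carrier G" "((h, i), (k, j)) \<in> E" for g h i k j
      using that by (auto simp: E_def image_iff)
    fix u v u' v' assume "(u, v) \<in> E" "(u', v') \<in> E"
    then obtain g j h k where *: "u = (g, c l + j)" "v = (g, j)" "u' = (h, c l + k)" "v' = (h, k)"
      "g \<in> carrier G" "h \<in> carrier G" "j < M" "k < M" by (auto simp: E_def)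
    then show "\<bar>\<sigma> u u' - \<theta> (Suc l) v v'\<bar> \<le> 2 * r"
      using slice[of l g h j k] step[rule_format, of l "(g, j)" "(h, k)"] Suc.prems by simp
  qed
  then obtain \<sigma>' where \<sigma>': "bounded_invariant \<sigma>'" "agree N' \<sigma> \<sigma>'"
    and new: "\<And>g h i j. g \<in> carrier G \<Longrightarrow> h \<in> carrier G \<Longrightarrow> \<sigma>' (g, N' + i) (h, N' + j) = \<theta> (Suc l) (g, i) (h, j)"
    and cross: "\<And>g i h j. ((g, i), (h, j)) \<in> E \<Longrightarrow> i < N' \<Longrightarrow> \<sigma>' (g, i) (h, N' + j) \<le> r"
    by blast
  have old: "\<sigma>' (g, i) (h, j) = \<sigma> (g, i) (h, j)" if "g \<in> carrier G" "h \<in> carrier G" "i < N'" "j < N'" for g h i j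
    using agreeD[OF \<sigma>'(2)] that by simp
  define c' where "c' = c(Suc l := N')"
  have c'c: "c' i = c i" if "i \<le> l" for i using that by (simp add: c'_def)
  have "c' i + M \<le> N' + M \<and> (\<forall>g\<in>carrier G. \<forall>h\<in>carrier G. \<forall>j<M. \<forall>k<M.
        \<sigma>' (g, c' i + j) (h, c' i + k) = \<theta> i (g, j) (h, k))" if "i \<le> Suc l" for i
  proof (cases "i = Suc l")
    case True
    then show ?thesis using new by (simp add: c'_def)
  next
    case False
    then have i: "i \<le> l" using that by simp
    show ?thesis
      using c[OF i] slice[OF i] old by (auto simp: c'c[OF i])
  qed
  moreover have "\<sigma>' (\<one>, c' i + j) (\<one>, c' (Suc i) + j) \<le> r" if "i < Suc l" "j < M" for i j
  proof (cases "i = l")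
    case True
    have "((\<one>, c l + j), (\<one>, j)) \<in> E" using that by (auto simp: E_def)
    moreover have "c l + j < N'" using c[of l] that by simp
    ultimately have "\<sigma>' (\<one>, c l + j) (\<one>, N' + j) \<le> r" by (rule cross)
    then show ?thesis using True by (simp add: c'_def)
  next
    case False
    then have i: "i < l" using that by simp
    then show ?thesis
      using adj[OF i that(2)] c[of i] c[of "Suc i"] that old[of \<one> \<one> "c i + j" "c (Suc i) + j"]
      by (simp add: c'c)
  qed
  ultimately show ?case
    using \<sigma>' \<sigma> agree_trans[OF \<sigma>(3) \<sigma>'(2) \<sigma>(2)]
    by (intro exI[of _ \<sigma>'] exI[of _ "N' + M"] exI[of _ c']) (auto simp: c'_def)
qed

text \<open>
  The core of the turbulence argument. Inside \<open>\<rho>\<close> there is a path of \<open>M\<close>-tuples of orbits, with steps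
  as small as desired, that starts at the first \<open>M\<close> orbits and ends at a tuple whose orbit metric
  imitates a given \<open>\<tau>\<close> on the finite set \<open>F\<close>, while in between the orbit metric interpolates linearly.
  Small steps require consecutive metrics to be uniformly close on all of the infinite group. This is
  where boundedness enters: \<open>\<tau>\<close> may be cut off at a constant \<open>R\<close> beyond its values on \<open>F\<close>, and then
  the two ends of the interpolation differ by at most \<open>R\<close>, so \<open>K > R / \<epsilon>\<close> steps suffice. The constant \<open>R\<close>
  depends on the first \<open>M\<close> orbits only, hence \<open>K\<close> does not depend on the stage.
\<close>

lemma generic_path:
  assumes gen: "generic \<rho>" and \<tau>: "invariant \<tau>" and F: "finite F" "F \<subseteq> carrier G"
    and M: "0 < M" and \<epsilon>: "0 < (\<epsilon> :: real)"
  obtains K s where "0 < K" "\<And>j. j < M \<Longrightarrow> s 0 j = j"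
    "\<And>i g h j k. i \<le> K \<Longrightarrow> g \<in> F \<Longrightarrow> h \<in> F \<Longrightarrow> j < M \<Longrightarrow> k < M \<Longrightarrow>
       \<bar>\<rho> (g, s i j) (h, s i k) -
         ((1 - real i / real K) * \<rho> (g, j) (h, k) + real i / real K * \<tau> (g, j) (h, k))\<bar> < \<epsilon>"
    "\<And>i j. i < K \<Longrightarrow> j < M \<Longrightarrow> \<rho> (\<one>, s i j) (\<one>, s (Suc i) j) < \<epsilon>"
proof -
  note inv\<rho> = generic_invariant[OF gen]
  obtain B where B: "\<And>x y. x \<in> carrier G \<times> {..<M} \<Longrightarrow> y \<in> carrier G \<times> {..<M} \<Longrightarrow> \<rho> x y \<le> B"
    using gen unfolding generic_def by meson
  define S where "S = insert 0 ((\<lambda>(x, y). \<tau> x y) ` ((F \<times> {..<M}) \<times> (F \<times> {..<M})))"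
  define R where "R = max B (Max S)"
  have finS: "finite S" using F(1) by (simp add: S_def)
  have "0 \<in> S" by (simp add: S_def)
  then have R0: "0 \<le> R" using Max_ge[OF finS, of 0] by (simp add: R_def le_max_iff_disj)
  have \<tau>R: "\<tau> x y \<le> R" if "x \<in> F \<times> {..<M}" "y \<in> F \<times> {..<M}" for x y
  proof -
    have "(x, y) \<in> (F \<times> {..<M}) \<times> (F \<times> {..<M})" using that by blast
    then have "\<tau> x y \<in> S" unfolding S_def by (metis (no_types, lifting) case_prod_conv image_eqI insertI2)
    then show ?thesis using Max_ge[OF finS] by (simp add: R_def le_max_iff_disj)
  qed
  obtain K where K: "R / \<epsilon> < real K" using reals_Archimedean2 by blast
  have K0: "0 < K" using K R0 \<epsilon> by (metis divide_nonneg_pos leD neq0_conv of_nat_0)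
  define r where "r = R / (2 * real K)"
  have r0: "0 \<le> r" using R0 by (simp add: r_def)
  have r\<epsilon>: "r \<le> \<epsilon> / 2" using K K0 \<epsilon> by (simp add: r_def field_simps)
  define \<tau>' where "\<tau>' x y = min R (\<tau> x y)" for x y
  define q where "q i x y = (1 - real i / real K) * \<rho> x y + real i / real K * \<tau>' x y" for i x y
  \<comment> \<open>the variable \<open>i * M + j\<close> stands for the \<open>j\<close>-th orbit of the \<open>i\<close>-th tuple; block 0 is fixed\<close>
  define base where "base = (\<lambda>(g :: 'a, j). (g, j mod M))"
  define lo where "lo x y = (if snd x div M = snd y div M then q (snd x div M) (base x) (base y) else 0)" for x y
  define hi where "hi x y = (if snd x div M = snd y div M then q (snd x div M) (base x) (base y) else \<epsilon> / 2)" for x y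
  \<comment> \<open>pairs within one block, whose distance is prescribed, and pairs of consecutive blocks,
    which have to be close\<close>
  define A where "A = (\<lambda>((i, g, h), (j, k)). ((g, i * M + j), (h, i * M + k))) ` (({..K} \<times> F \<times> F) \<times> {..<M} \<times> {..<M})
      \<union> (\<lambda>(i, j). ((\<one>, i * M + j), (\<one>, Suc i * M + j))) ` ({..<K} \<times> {..<M})"
  have dm: "(i * M + j) div M = i" if "j < M" for i j using that by auto
  have "\<exists>s. (\<forall>j<M. s j = j) \<and> (\<forall>(x, y)\<in>A. lo x y - \<epsilon> / 2 < \<rho> (apsnd s x) (apsnd s y) \<and>
      \<rho> (apsnd s x) (apsnd s y) < hi x y + \<epsilon> / 2)"
  proof (rule generic_realizes[OF gen])
    show "finite A" unfolding A_def using F(1) by auto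
    show "A \<subseteq> points \<times> points" unfolding A_def using F(2) by auto
    show "0 < \<epsilon> / 2" using \<epsilon> by simp
    fix \<sigma> N assume N: "M \<le> N" and \<sigma>: "bounded_invariant \<sigma>" and ag: "agree N \<rho> \<sigma>"
    have \<sigma>\<rho>: "\<sigma> x y = \<rho> x y" if "x \<in> carrier G \<times> {..<M}" "y \<in> carrier G \<times> {..<M}" for x y
      by (rule agreeD[OF ag]) (use that N in auto)
    define \<theta> where "\<theta> i x y = (1 - real i / real K) * \<sigma> x y + real i / real K * \<tau>' x y" for i x y
    have \<tau>'b: "bounded_invariant \<tau>'" unfolding \<tau>'_def by (rule bounded_invariant_min[OF \<tau> R0])
    have bi: "bounded_invariant (\<theta> i)" if "i \<le> K" for i
      unfolding \<theta>_def using that K0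
      by (intro bounded_invariant_convex \<sigma> \<tau>'b) (auto simp: field_simps)
    have step: "\<bar>\<theta> i x y - \<theta> (Suc i) x y\<bar> \<le> 2 * r"
      if "x \<in> carrier G \<times> {..<M}" "y \<in> carrier G \<times> {..<M}" for i x y
    proof -
      have "\<theta> i x y - \<theta> (Suc i) x y = (\<sigma> x y - \<tau>' x y) / real K"
        using K0 by (simp add: \<theta>_def field_simps)
      moreover have "\<bar>\<sigma> x y - \<tau>' x y\<bar> \<le> R"
      proof -
        have p: "x \<in> points" "y \<in> points" using that by auto
        have "0 \<le> \<sigma> x y" "0 \<le> \<tau>' x y"
          using pseudometric_on_nonneg[OF bounded_invariant_pseudometric] \<sigma> \<tau>'b p by blast+
        moreover have "\<sigma> x y \<le> R" using \<sigma>\<rho>[OF that] B[OF that] by (simp add: R_def)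
        moreover have "\<tau>' x y \<le> R" by (simp add: \<tau>'_def)
        ultimately show ?thesis by linarith
      qed
      ultimately show ?thesis using K0 by (simp add: r_def divide_right_mono)
    qed
    have bi': "\<forall>l\<le>K. bounded_invariant (\<theta> l)" using bi by blast
    have step': "\<forall>l<K. \<forall>x\<in>carrier G \<times> {..<M}. \<forall>y\<in>carrier G \<times> {..<M}.
        \<bar>\<theta> l x y - \<theta> (Suc l) x y\<bar> \<le> 2 * r"
      using step by blast
    have \<theta>0: "\<theta> 0 = \<sigma>" by (intro ext) (simp add: \<theta>_def)
    obtain \<sigma>' N' c where path: "bounded_invariant \<sigma>' \<and> N \<le> N' \<and> agree N (\<theta> 0) \<sigma>' \<and> c 0 = 0 \<and>
        (\<forall>i\<le>K. c i + M \<le> N' \<and> (\<forall>g\<in>carrier G. \<forall>h\<in>carrier G. \<forall>j<M. \<forall>k<M.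
          \<sigma>' (g, c i + j) (h, c i + k) = \<theta> i (g, j) (h, k))) \<and>
        (\<forall>i<K. \<forall>j<M. \<sigma>' (\<one>, c i + j) (\<one>, c (Suc i) + j) \<le> r)"
      using glued_path[where \<theta> = \<theta> and l = K, OF bi' M N r0 step' order_refl] by (elim exE)
    then have \<sigma>': "bounded_invariant \<sigma>'" "N \<le> N'" "agree N \<sigma> \<sigma>'" "c 0 = 0"
      by (simp_all add: \<theta>0)
    have c: "c i + M \<le> N'" if "i \<le> K" for i using path that by blast
    have slice: "\<sigma>' (g, c i + j) (h, c i + k) = \<theta> i (g, j) (h, k)"
      if "i \<le> K" "g \<in> carrier G" "h \<in> carrier G" "j < M" "k < M" for i g h j k
      using path that by blast
    have adj: "\<sigma>' (\<one>, c i + j) (\<one>, c (Suc i) + j) \<le> r" if "i < K" "j < M" for i j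
      using path that by blast
    define s where "s a = c (a div M) + a mod M" for a
    have s: "s (i * M + j) = c i + j" if "j < M" for i j using that by (simp add: s_def)
    have "s (snd x) < N' \<and> s (snd y) < N' \<and>
          lo x y \<le> \<sigma>' (apsnd s x) (apsnd s y) \<and> \<sigma>' (apsnd s x) (apsnd s y) \<le> hi x y"
      if "(x, y) \<in> A" for x y
      using that unfolding A_def
    proof (elim UnE)
      assume "(x, y) \<in> (\<lambda>((i, g, h), (j, k)). ((g, i * M + j), (h, i * M + k))) ` (({..K} \<times> F \<times> F) \<times> {..<M} \<times> {..<M})"
      then obtain i g h j k where *: "x = (g, i * M + j)" "y = (h, i * M + k)" "i \<le> K" "g \<in> F" "h \<in> F" "j < M" "k < M"
        by auto
      have gh: "g \<in> carrier G" "h \<in> carrier G" using * F(2) by auto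
      have "\<theta> i (g, j) (h, k) = q i (g, j) (h, k)"
        using \<sigma>\<rho>[of "(g, j)" "(h, k)"] gh * by (simp add: \<theta>_def q_def)
      then show ?thesis
        using slice[OF *(3) gh *(6,7)] c[OF *(3)] *(6,7)
        by (simp add: *(1,2) s lo_def hi_def base_def)
    next
      assume "(x, y) \<in> (\<lambda>(i, j). ((\<one>, i * M + j), (\<one>, Suc i * M + j))) ` ({..<K} \<times> {..<M})"
      then obtain i j where *: "x = (\<one>, i * M + j)" "y = (\<one>, Suc i * M + j)" "i < K" "j < M" by auto
      note d = dm[OF *(4), of i] dm[OF *(4), of "Suc i"]
      have "0 \<le> \<sigma>' (\<one>, c i + j) (\<one>, c (Suc i) + j)"
        using pseudometric_on_nonneg[OF bounded_invariant_pseudometric[OF \<sigma>'(1)]] by simp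
      then show ?thesis
        using adj[OF *(3,4)] c[of i] c[of "Suc i"] *(3,4) r\<epsilon> s[OF *(4), of i] s[OF *(4), of "Suc i"]
        unfolding *(1,2) lo_def hi_def by (simp add: d del: mult_Suc)
    qed
    then show "\<exists>\<sigma>' N' s. bounded_invariant \<sigma>' \<and> N \<le> N' \<and> agree N \<sigma> \<sigma>' \<and> (\<forall>j<M. s j = j) \<and>
        (\<forall>(x, y)\<in>A. s (snd x) < N' \<and> s (snd y) < N' \<and>
          lo x y \<le> \<sigma>' (apsnd s x) (apsnd s y) \<and> \<sigma>' (apsnd s x) (apsnd s y) \<le> hi x y)"
      using \<sigma>' by (intro exI[of _ \<sigma>'] exI[of _ N'] exI[of _ s]) (auto simp: s_def)
  qed
  then obtain s where s: "\<And>j. j < M \<Longrightarrow> s j = j"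
    and sA: "\<And>x y. (x, y) \<in> A \<Longrightarrow> lo x y - \<epsilon> / 2 < \<rho> (apsnd s x) (apsnd s y) \<and>
      \<rho> (apsnd s x) (apsnd s y) < hi x y + \<epsilon> / 2"
    by blast
  have close: "\<bar>a - b\<bar> < \<epsilon>" if "b - \<epsilon> / 2 < a" "a < b + \<epsilon> / 2" for a b :: real
    using that \<epsilon> by linarith
  have 1: "\<bar>\<rho> (g, s (i * M + j)) (h, s (i * M + k)) -
         ((1 - real i / real K) * \<rho> (g, j) (h, k) + real i / real K * \<tau> (g, j) (h, k))\<bar> < \<epsilon>"
    if *: "i \<le> K" "g \<in> F" "h \<in> F" "j < M" "k < M" for i g h j k
  proof -
    have "((g, i * M + j), (h, i * M + k)) \<in> A"
      unfolding A_def using * by (intro UnI1 image_eqI[of _ _ "((i, g, h), (j, k))"]) auto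
    note sA[OF this]
    moreover have "\<tau>' (g, j) (h, k) = \<tau> (g, j) (h, k)" using \<tau>R[of "(g, j)" "(h, k)"] * by (simp add: \<tau>'_def)
    then have "lo (g, i * M + j) (h, i * M + k) =
        (1 - real i / real K) * \<rho> (g, j) (h, k) + real i / real K * \<tau> (g, j) (h, k)"
      "hi (g, i * M + j) (h, i * M + k) =
        (1 - real i / real K) * \<rho> (g, j) (h, k) + real i / real K * \<tau> (g, j) (h, k)"
      using * by (simp_all add: lo_def hi_def q_def base_def)
    ultimately show ?thesis by (intro close) simp_all
  qed
  have 2: "\<rho> (\<one>, s (i * M + j)) (\<one>, s (Suc i * M + j)) < \<epsilon>" if *: "i < K" "j < M" for i j
  proof -
    have "((\<one>, i * M + j), (\<one>, Suc i * M + j)) \<in> A"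
      unfolding A_def using * by (intro UnI2 image_eqI[of _ _ "(i, j)"]) auto
    note sA[OF this]
    moreover note dm[OF *(2), of i] dm[OF *(2), of "Suc i"]
    then have "hi (\<one>, i * M + j) (\<one>, Suc i * M + j) = \<epsilon> / 2"
      unfolding hi_def by (simp del: mult_Suc)
    ultimately show ?thesis by simp
  qed
  show ?thesis
    by (rule that[of K "\<lambda>i j. s (i * M + j)"]) (use K0 s 1 2 in auto)
qed

end

section \<open>Basic neighbourhoods of isometries and representations\<close>

text \<open>
  Isometries are determined by their values on a dense sequence, and this is true uniformly: if \<open>z n\<close> is
  close to \<open>i\<close>, then \<open>f (z n)\<close> and \<open>f i\<close> are equally close for every isometry \<open>f\<close>. Hence finitely many
  conditions at points of \<open>z\<close> suffice to describe a neighbourhood. The next lemma transfers this to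
  representations.
\<close>

lemma Iso_ball_subset:
  fixes z :: "nat \<Rightarrow> 'u::metric_space"
  assumes z: "closure (range z) = UNIV" and V: "openin Iso_topology V" "f \<in> V"
  shows "\<exists>M>0. \<exists>\<epsilon>>0. \<forall>f'\<in>carrier Iso. (\<forall>j<M. dist (f' (z j)) (f (z j)) < \<epsilon>) \<longrightarrow> f' \<in> V"
proof -
  obtain W where W: "open W" "V = W \<inter> carrier Iso"
    using V(1) unfolding Iso_topology_def openin_subtopology open_openin[symmetric] by blast
  have fI: "f \<in> carrier Iso" using V(2) W by simp
  have "openin (product_topology (\<lambda>_. euclidean) UNIV) W"
    using W(1) by (simp add: euclidean_product_topology open_openin[symmetric])
  from product_topology_open_contains_basis[OF this, of f] obtain X where
    X: "f \<in> (\<Pi>\<^sub>E i\<in>UNIV. X i)" "\<And>i. open (X i)" "finite {i. X i \<noteq> UNIV}" "(\<Pi>\<^sub>E i\<in>UNIV. X i) \<subseteq> W"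
    using V(2) W(2) by (auto simp: open_openin[symmetric])
  define J where "J = {i. X i \<noteq> UNIV}"
  have "\<forall>i. \<exists>n e. 0 < e \<and> (\<forall>f'\<in>carrier Iso. dist (f' (z n)) (f (z n)) < e \<longrightarrow> f' i \<in> X i)"
  proof
    fix i
    have "f i \<in> X i" using X(1) by auto
    then obtain e where e: "0 < e" "ball (f i) e \<subseteq> X i" using X(2) open_contains_ball by blast
    have "i \<in> closure (range z)" using z by simp
    then obtain n where n: "dist (z n) i < e / 3"
      using e(1) unfolding closure_approachable by (metis rangeE zero_less_divide_iff zero_less_numeral)
    have "f' i \<in> X i" if "f' \<in> carrier Iso" "dist (f' (z n)) (f (z n)) < e / 3" for f'
    proof -
      have "dist (f i) (f' i) \<le> dist (f i) (f (z n)) + (dist (f (z n)) (f' (z n)) + dist (f' (z n)) (f' i))"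
        by (meson add_left_mono dist_triangle order_trans)
      also have "\<dots> = 2 * dist (z n) i + dist (f' (z n)) (f (z n))"
        using Iso_dist[OF fI] Iso_dist[OF that(1)] by (simp add: dist_commute)
      also have "\<dots> < e" using n that(2) by simp
      finally show ?thesis using e(2) by auto
    qed
    then show "\<exists>n e. 0 < e \<and> (\<forall>f'\<in>carrier Iso. dist (f' (z n)) (f (z n)) < e \<longrightarrow> f' i \<in> X i)"
      using e(1) by (intro exI[of _ n] exI[of _ "e / 3"]) auto
  qed
  then obtain n e where ne: "\<And>i. 0 < e i"
      "\<And>i f'. f' \<in> carrier Iso \<Longrightarrow> dist (f' (z (n i))) (f (z (n i))) < e i \<Longrightarrow> f' i \<in> X i"
    by metis
  define M where "M = Suc (Max (insert 0 (n ` J)))"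
  define \<epsilon> where "\<epsilon> = Min (insert 1 (e ` J))"
  have fin: "finite J" using X(3) by (simp add: J_def)
  have nM: "n i < M" if "i \<in> J" for i
    using that fin by (auto simp: M_def less_Suc_eq_le intro: Max_ge)
  have e\<epsilon>: "\<epsilon> \<le> e i" if "i \<in> J" for i
    using that fin by (auto simp: \<epsilon>_def intro: Min_le)
  have "0 < \<epsilon>" using fin ne(1) by (simp add: \<epsilon>_def)
  moreover have "0 < M" by (simp add: M_def)
  moreover have "f' \<in> V" if f': "f' \<in> carrier Iso" "\<forall>j<M. dist (f' (z j)) (f (z j)) < \<epsilon>" for f'
  proof -
    have "f' i \<in> X i" for i
    proof (cases "i \<in> J")
      case True
      then show ?thesis using f' nM[OF True] e\<epsilon>[OF True] by (intro ne(2)) fastforce+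
    qed (simp add: J_def)
    then have "f' \<in> W" using X(4) by auto
    then show ?thesis using W(2) f'(1) by simp
  qed
  ultimately show ?thesis by blast
qed

lemma Rep_carrier: "\<pi> \<in> Rep \<Gamma> \<Longrightarrow> g \<in> carrier \<Gamma> \<Longrightarrow> \<pi> g \<in> carrier Iso"
  by (auto simp: Rep_def hom_def)

lemma Rep_mult:
  "\<pi> \<in> Rep \<Gamma> \<Longrightarrow> g \<in> carrier \<Gamma> \<Longrightarrow> h \<in> carrier \<Gamma> \<Longrightarrow> \<pi> (g \<otimes>\<^bsub>\<Gamma>\<^esub> h) x = \<pi> g (\<pi> h x)"
  by (auto simp: Rep_def hom_def Iso_def)

lemma Rep_one:
  assumes "group \<Gamma>" "\<pi> \<in> Rep \<Gamma>"
  shows "\<pi> \<one>\<^bsub>\<Gamma>\<^esub> (x :: 'u::metric_space) = x"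
proof -
  interpret group_hom \<Gamma> "Iso :: ('u \<Rightarrow> 'u) monoid" \<pi>
    using assms by (simp add: group_hom_def group_hom_axioms_def group_Iso Rep_def)
  show ?thesis using hom_one by (simp add: Iso_def)
qed

lemma Rep_ball_subset:
  fixes z :: "nat \<Rightarrow> 'u::metric_space"
  assumes \<Gamma>: "group \<Gamma>" and z: "closure (range z) = UNIV"
    and U: "openin (Rep_topology \<Gamma>) U" "\<pi> \<in> U"
  shows "\<exists>F M \<epsilon>. finite F \<and> F \<subseteq> carrier \<Gamma> \<and> \<one>\<^bsub>\<Gamma>\<^esub> \<in> F \<and> 0 < M \<and> 0 < \<epsilon> \<and>
    (\<forall>\<pi>'\<in>Rep \<Gamma>. (\<forall>g\<in>F. \<forall>j<M. dist (\<pi>' g (z j)) (\<pi> g (z j)) < \<epsilon>) \<longrightarrow> \<pi>' \<in> U)"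
proof -
  interpret \<Gamma>: group \<Gamma> by fact
  obtain W where W: "openin (product_topology (\<lambda>_. Iso_topology) (carrier \<Gamma>)) W" "U = W \<inter> Rep \<Gamma>"
    using U(1) unfolding Rep_topology_def openin_subtopology by auto
  from product_topology_open_contains_basis[OF W(1), of \<pi>] obtain X where
    X: "\<pi> \<in> (\<Pi>\<^sub>E g\<in>carrier \<Gamma>. X g)" "\<And>g. openin Iso_topology (X g)"
      "finite {g. X g \<noteq> carrier Iso}" "(\<Pi>\<^sub>E g\<in>carrier \<Gamma>. X g) \<subseteq> W"
    using U(2) W(2) by auto
  define J where "J = {g \<in> carrier \<Gamma>. X g \<noteq> carrier Iso}"
  have fin: "finite J" using X(3) by (rule rev_finite_subset) (auto simp: J_def)
  have "\<forall>g. \<exists>M e. g \<in> carrier \<Gamma> \<longrightarrow> 0 < e \<and>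
      (\<forall>f\<in>carrier Iso. (\<forall>j<M. dist (f (z j)) (\<pi> g (z j)) < e) \<longrightarrow> f \<in> X g)"
  proof
    fix g
    show "\<exists>M e. g \<in> carrier \<Gamma> \<longrightarrow> 0 < e \<and>
      (\<forall>f\<in>carrier Iso. (\<forall>j<M. dist (f (z j)) (\<pi> g (z j)) < e) \<longrightarrow> f \<in> X g)"
    proof (cases "g \<in> carrier \<Gamma>")
      case True
      then have "\<pi> g \<in> X g" using X(1) by auto
      from Iso_ball_subset[OF z X(2) this] show ?thesis by blast
    qed simp
  qed
  then obtain m e where me: "\<And>g. g \<in> carrier \<Gamma> \<Longrightarrow> 0 < e g"
    "\<And>g f. g \<in> carrier \<Gamma> \<Longrightarrow> f \<in> carrier Iso \<Longrightarrow> \<forall>j<m g. dist (f (z j)) (\<pi> g (z j)) < e g \<Longrightarrow> f \<in> X g"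
    by metis
  define M where "M = Suc (Max (insert 0 (m ` J)))"
  define \<epsilon> where "\<epsilon> = Min (insert 1 (e ` J))"
  have mM: "m g \<le> M" if "g \<in> J" for g
    using that fin by (auto simp: M_def intro!: le_SucI Max_ge)
  have e\<epsilon>: "\<epsilon> \<le> e g" if "g \<in> J" for g
    using that fin by (auto simp: \<epsilon>_def intro: Min_le)
  have "0 < \<epsilon>" using fin me(1) by (auto simp: \<epsilon>_def J_def)
  moreover have "0 < M" by (simp add: M_def)
  moreover have "\<pi>' \<in> U" if \<pi>': "\<pi>' \<in> Rep \<Gamma>"
    "\<forall>g\<in>insert \<one>\<^bsub>\<Gamma>\<^esub> J. \<forall>j<M. dist (\<pi>' g (z j)) (\<pi> g (z j)) < \<epsilon>" for \<pi>'
  proof -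
    have "\<pi>' g \<in> X g" if g: "g \<in> carrier \<Gamma>" for g
    proof (cases "g \<in> J")
      case True
      have "\<forall>j<m g. dist (\<pi>' g (z j)) (\<pi> g (z j)) < e g"
        using \<pi>'(2) True mM[OF True] e\<epsilon>[OF True] by (meson insertI2 less_le_trans)
      then show ?thesis by (rule me(2)[OF g Rep_carrier[OF \<pi>'(1) g]])
    next
      case False
      then show ?thesis using g Rep_carrier[OF \<pi>'(1) g] by (auto simp: J_def)
    qed
    moreover have "\<pi>' \<in> extensional (carrier \<Gamma>)" using \<pi>'(1) by (simp add: Rep_def)
    ultimately have "\<pi>' \<in> W" using X(4) by (auto simp: PiE_def)
    then show ?thesis using W(2) \<pi>'(1) by simp
  qed
  ultimately show ?thesis
    using fin by (intro exI[of _ "insert \<one>\<^bsub>\<Gamma>\<^esub> J"] exI[of _ M] exI[of _ \<epsilon>]) (auto simp: J_def)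
qed

lemma openin_Rep_ball:
  fixes z :: "nat \<Rightarrow> 'u::metric_space"
  assumes F: "finite F" "F \<subseteq> carrier \<Gamma>"
  shows "openin (Rep_topology \<Gamma>) {\<pi> \<in> Rep \<Gamma>. \<forall>g\<in>F. \<forall>j<M. dist (\<pi> g (z j)) (w g j) < (\<epsilon> :: real)}"
proof -
  define B where "B = (\<lambda>(g, j). {\<pi> \<in> Rep \<Gamma>. \<pi> g (z j) \<in> {u. dist u (w g j) < \<epsilon>}})"
  have "openin (Rep_topology \<Gamma>) (B p)" if pF: "p \<in> F \<times> {..<M}" for p
  proof -
    obtain g j where p: "p = (g, j)" "g \<in> carrier \<Gamma>" using pF F(2) by (cases p) auto
    have "continuous_map (product_topology (\<lambda>_. Iso_topology :: ('u \<Rightarrow> 'u) topology) (carrier \<Gamma>)) Iso_topology (\<lambda>\<pi>. \<pi> g)"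
      using p(2) by (rule continuous_map_product_projection)
    then have "continuous_map (Rep_topology \<Gamma>) Iso_topology (\<lambda>\<pi>. \<pi> g :: 'u \<Rightarrow> 'u)"
      unfolding Rep_topology_def by (rule continuous_map_from_subtopology)
    moreover have "continuous_map Iso_topology euclidean (\<lambda>f :: 'u \<Rightarrow> 'u. f (z j))"
      unfolding Iso_topology_def
      by (intro continuous_map_from_subtopology) (simp add: continuous_on_product_coordinates)
    ultimately have "continuous_map (Rep_topology \<Gamma>) euclidean (\<lambda>\<pi>. \<pi> g (z j) :: 'u)"
      using continuous_map_compose[of "Rep_topology \<Gamma>" Iso_topology "\<lambda>\<pi>. \<pi> g"] by (auto simp: comp_def)
    moreover have "open {u. dist u (w g j) < \<epsilon>}"
      using open_ball[of "w g j" \<epsilon>] by (simp add: ball_def dist_commute)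
    ultimately have "openin (Rep_topology \<Gamma>)
        {\<pi> \<in> topspace (Rep_topology \<Gamma>). \<pi> g (z j) \<in> {u. dist u (w g j) < \<epsilon>}}"
      by (intro openin_continuous_map_preimage[of _ euclidean]) (simp_all add: open_openin[symmetric])
    then show ?thesis by (simp add: B_def p(1))
  qed
  then have "openin (Rep_topology \<Gamma>) ((\<Inter>p\<in>F \<times> {..<M}. B p) \<inter> topspace (Rep_topology \<Gamma>))"
    using F(1) by (intro openin_INT) auto
  also have "(\<Inter>p\<in>F \<times> {..<M}. B p) \<inter> topspace (Rep_topology \<Gamma>) =
      {\<pi> \<in> Rep \<Gamma>. \<forall>g\<in>F. \<forall>j<M. dist (\<pi> g (z j)) (w g j) < \<epsilon>}"
    by (auto simp: B_def)
  finally show ?thesis .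
qed

section \<open>Representations with a generic orbit metric\<close>

lemma Iso_mult: "f \<otimes>\<^bsub>Iso\<^esub> g = f \<circ> g"
  by (simp add: Iso_def)

lemma Iso_one: "\<one>\<^bsub>Iso\<^esub> = id"
  by (simp add: Iso_def)

lemma Iso_inv_apply:
  assumes "h \<in> carrier (Iso :: ('u::metric_space \<Rightarrow> 'u) monoid)"
  shows "h ((inv\<^bsub>Iso\<^esub> h) x) = x" and "inv\<^bsub>Iso\<^esub> h \<in> carrier Iso"
proof -
  interpret I: group "Iso :: ('u \<Rightarrow> 'u) monoid" by (rule group_Iso)
  have "h \<circ> inv\<^bsub>Iso\<^esub> h = id" using I.r_inv[OF assms] by (simp only: Iso_mult Iso_one)
  then show "h ((inv\<^bsub>Iso\<^esub> h) x) = x" by (metis comp_apply id_apply)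
  show "inv\<^bsub>Iso\<^esub> h \<in> carrier Iso" using assms by simp
qed

text \<open>
  Turns a path of group elements starting at the unit into a word whose letters are the increments.
\<close>

lemma word_prod_telescope:
  assumes "group A" "\<And>i. H i \<in> carrier A" "H 0 = \<one>\<^bsub>A\<^esub>"
  shows "word_prod A (\<lambda>i. H i \<otimes>\<^bsub>A\<^esub> inv\<^bsub>A\<^esub> H (i - 1)) n = H n"
proof (induction n)
  case (Suc n)
  interpret A: group A by fact
  show ?case using assms(2) Suc by (simp add: A.m_assoc)
qed (simp add: assms(3))

context countable_group
begin

text \<open>
  \<open>z\<close> is a dense sequence of base points and \<open>\<rho>\<close> is the metric induced on their orbits.
\<close>

definition generic_rep ::
    "('a \<Rightarrow> 'u::metric_space \<Rightarrow> 'u) \<Rightarrow> (nat \<Rightarrow> 'u) \<Rightarrow> ('a \<times> nat \<Rightarrow> 'a \<times> nat \<Rightarrow> real) \<Rightarrow> bool" where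
  "generic_rep \<alpha> z \<rho> \<longleftrightarrow> \<alpha> \<in> Rep G \<and> closure (range z) = UNIV \<and> generic \<rho> \<and>
     (\<forall>g\<in>carrier G. \<forall>h\<in>carrier G. \<forall>i j. dist (\<alpha> g (z i)) (\<alpha> h (z j)) = \<rho> (g, i) (h, j))"

text \<open>
  By its extension property, a generic \<open>\<rho>\<close> embeds isometrically in the Urysohn space with the base
  points dense. Left translation preserves \<open>\<rho>\<close>, so it extends to isometries of the Urysohn space, and
  these compose as they should because they do so on a dense set.
\<close>

lemma exists_generic_rep:
  assumes u: "is_urysohn_space TYPE('u::polish_space)"
  shows "\<exists>(\<alpha> :: 'a \<Rightarrow> 'u \<Rightarrow> 'u) z \<rho>. generic_rep \<alpha> z \<rho>"
proof -
  obtain \<rho> where gen: "generic \<rho>" using exists_generic by blast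
  note inv = generic_invariant[OF gen]
  note ps = invariant_pseudometric[OF inv]
  have "\<exists>e :: 'a \<times> nat \<Rightarrow> 'u. (\<forall>x\<in>points. \<forall>y\<in>points. dist (e x) (e y) = \<rho> x y) \<and>
      closure (e ` ({\<one>} \<times> UNIV)) = UNIV"
  proof (rule urysohn_dense_embedding[OF u _ _ ps])
    show "countable points" using countable_carrier by auto
    show "points \<noteq> {}" "{\<one>} \<times> UNIV \<subseteq> points" by auto
    fix F f and \<epsilon> :: real
    assume F: "finite F" "F \<noteq> {}" "F \<subseteq> points" "0 < \<epsilon>"
      and f: "\<And>x y. x \<in> F \<Longrightarrow> y \<in> F \<Longrightarrow> \<bar>f x - f y\<bar> \<le> \<rho> x y \<and> \<rho> x y \<le> f x + f y"
    obtain j where "\<forall>x\<in>F. \<bar>\<rho> (\<one>, j) x - f x\<bar> < \<epsilon>"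
      using generic_extension[OF gen F f] by blast
    then show "\<exists>p\<in>{\<one>} \<times> UNIV. \<forall>x\<in>F. \<bar>\<rho> p x - f x\<bar> < \<epsilon>" by (intro bexI[of _ "(\<one>, j)"]) auto
  qed
  then obtain e :: "'a \<times> nat \<Rightarrow> 'u" where
    e: "\<And>x y. x \<in> points \<Longrightarrow> y \<in> points \<Longrightarrow> dist (e x) (e y) = \<rho> x y"
    and dense: "closure (e ` ({\<one>} \<times> UNIV)) = UNIV"
    by blast
  have dense': "closure (e ` points) = UNIV"
    using closure_mono[of "e ` ({\<one>} \<times> UNIV)" "e ` points"] dense by auto
  have "\<exists>a. (\<forall>x y. dist (a x) (a y) = dist x y) \<and> (\<forall>p\<in>points. a (e p) = e (g \<otimes> fst p, snd p))"
    if g: "g \<in> carrier G" for g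
  proof (rule isometry_extension[OF dense'])
    fix x y assume "x \<in> points" "y \<in> points"
    then show "dist (e (g \<otimes> fst x, snd x)) (e (g \<otimes> fst y, snd y)) = dist (e x) (e y)"
      using g invariant_translate[OF inv g] by (auto simp: e)
  qed (use g in auto)
  then obtain a where a: "\<And>g x y. g \<in> carrier G \<Longrightarrow> dist (a g x) (a g y) = dist x y"
    and ae: "\<And>g h j. g \<in> carrier G \<Longrightarrow> h \<in> carrier G \<Longrightarrow> a g (e (h, j)) = e (g \<otimes> h, j)"
    by (metis (no_types, lifting) SigmaI UNIV_I fst_conv snd_conv)
  have mult: "a (g \<otimes> h) = a g \<circ> a h" if "g \<in> carrier G" "h \<in> carrier G" for g h
    by (rule isometries_eq_if_eq_on_dense[OF dense']) (use that a ae in \<open>auto simp: m_assoc\<close>)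
  have one: "a \<one> = id"
    by (rule isometries_eq_if_eq_on_dense[OF dense']) (use a ae in auto)
  have iso: "a g \<in> carrier Iso" if g: "g \<in> carrier G" for g
  proof -
    have "a g \<circ> a (inv g) = id" using mult[of g "inv g"] g one by simp
    then have "a g (a (inv g) x) = x" for x by (metis comp_apply id_apply)
    then have "surj (a g)" by (rule surjI)
    then show ?thesis using a[OF g] by (simp add: Iso_def)
  qed
  define \<alpha> where "\<alpha> = restrict a (carrier G)"
  define z where "z j = e (\<one>, j)" for j
  have "\<alpha> \<in> Rep G"
    using iso mult unfolding Rep_def hom_def \<alpha>_def by (auto simp: Iso_def)
  moreover have "range z = e ` ({\<one>} \<times> UNIV)" by (auto simp: z_def)
  then have "closure (range z) = UNIV" using dense by simp
  moreover have "dist (\<alpha> g (z i)) (\<alpha> h (z j)) = \<rho> (g, i) (h, j)"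
    if "g \<in> carrier G" "h \<in> carrier G" for g h i j
    using that by (simp add: \<alpha>_def z_def ae e)
  ultimately show ?thesis using gen unfolding generic_rep_def by blast
qed

lemma conj_action_apply:
  assumes "h \<in> carrier Iso" "\<pi> \<in> Rep G" "g \<in> carrier G"
  shows "conj_action G h \<pi> g x = h (\<pi> g ((inv\<^bsub>Iso\<^esub> h) x))"
  using assms by (simp add: conj_action_def Iso_mult)

text \<open>
  Conjugates of \<open>\<alpha>\<close> near a given behaviour correspond to tuples with a given orbit metric. If the orbits
  of \<open>z (s 0), z (s 1), \<dots>\<close> under \<open>\<alpha>\<close> look, on \<open>F\<close>, like the family \<open>w\<close> that starts at \<open>z\<close>, then an
  isometry \<open>H\<close> that moves the former configuration near the latter conjugates \<open>\<alpha>\<close> to an action that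
  sends \<open>z j\<close> near \<open>w g j\<close>.
\<close>

lemma conjugate_near:
  fixes z :: "nat \<Rightarrow> 'u::polish_space" and w :: "'a \<Rightarrow> nat \<Rightarrow> 'u"
  assumes u: "is_urysohn_space TYPE('u)" and \<alpha>: "generic_rep \<alpha> z \<rho>"
    and F: "finite F" "F \<subseteq> carrier G" "\<one> \<in> F" and M: "0 < M" and r: "0 \<le> r"
    and w1: "\<And>j. j < M \<Longrightarrow> w \<one> j = z j"
    and near: "\<And>g h j k. g \<in> F \<Longrightarrow> h \<in> F \<Longrightarrow> j < M \<Longrightarrow> k < M \<Longrightarrow>
        \<bar>\<rho> (g, s j) (h, s k) - dist (w g j) (w h k)\<bar> \<le> 2 * r"
  shows "\<exists>H\<in>carrier Iso. (\<forall>j<M. dist (H (z (s j))) (z j) \<le> r) \<and>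
    (\<forall>g\<in>F. \<forall>j<M. dist (conj_action G H \<alpha> g (z j)) (w g j) \<le> 2 * r)"
proof -
  have Rep: "\<alpha> \<in> Rep G"
    and d: "\<And>g h i j. g \<in> carrier G \<Longrightarrow> h \<in> carrier G \<Longrightarrow> dist (\<alpha> g (z i)) (\<alpha> h (z j)) = \<rho> (g, i) (h, j)"
    using \<alpha> by (auto simp: generic_rep_def)
  define p where "p = (\<lambda>(g, j). w g j)"
  define q where "q = (\<lambda>(g, j). \<alpha> g (z (s j)))"
  have "\<exists>H\<in>carrier Iso. \<forall>i\<in>F \<times> {..<M}. dist (H (q i)) (p i) \<le> r"
  proof (rule urysohn_approx_homogeneous[OF u _ _ r])
    show "finite (F \<times> {..<M})" "F \<times> {..<M} \<noteq> {}" using F M by auto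
    fix i k assume "i \<in> F \<times> {..<M}" "k \<in> F \<times> {..<M}"
    then obtain g j h l where *: "i = (g, j)" "k = (h, l)" "g \<in> F" "h \<in> F" "j < M" "l < M" by auto
    moreover have "g \<in> carrier G" "h \<in> carrier G" using * F(2) by auto
    ultimately show "\<bar>dist (p i) (p k) - dist (q i) (q k)\<bar> \<le> 2 * r"
      using near[of g h j l] d[of g h "s j" "s l"] by (simp add: p_def q_def abs_minus_commute)
  qed
  then obtain H where H: "H \<in> carrier Iso" "\<And>g j. g \<in> F \<Longrightarrow> j < M \<Longrightarrow> dist (H (\<alpha> g (z (s j)))) (w g j) \<le> r"
    by (auto simp: p_def q_def)
  have H1: "dist (H (z (s j))) (z j) \<le> r" if "j < M" for j
    using H(2)[OF F(3) that] w1[OF that] Rep_one[OF is_group Rep] by simp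
  moreover have "dist (conj_action G H \<alpha> g (z j)) (w g j) \<le> 2 * r" if gj: "g \<in> F" "j < M" for g j
  proof -
    have g: "g \<in> carrier G" using gj F(2) by auto
    let ?x = "(inv\<^bsub>Iso\<^esub> H) (z j)"
    have "dist (H (\<alpha> g ?x)) (H (\<alpha> g (z (s j)))) = dist (H ?x) (H (z (s j)))"
      using Iso_dist[OF H(1)] Iso_dist[OF Rep_carrier[OF Rep g]] by simp
    also have "\<dots> \<le> r" using H1[OF gj(2)] by (simp add: Iso_inv_apply(1)[OF H(1)] dist_commute)
    finally show ?thesis
      using dist_triangle[of "H (\<alpha> g ?x)" "w g j" "H (\<alpha> g (z (s j)))"] H(2)[OF gj]
      by (simp add: conj_action_apply[OF H(1) Rep g])
  qed
  ultimately show ?thesis using H(1) by blast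
qed

lemma Rep_orbit_metric_invariant:
  assumes "\<pi> \<in> Rep G"
  shows "invariant (\<lambda>(g, i) (h, j). dist (\<pi> g (z i)) (\<pi> h (z j)))"
  unfolding invariant_def
proof (intro conjI ballI allI)
  show "pseudometric_on points (\<lambda>(g, i) (h, j). dist (\<pi> g (z i)) (\<pi> h (z j)))"
    by (rule pseudometric_onI) (auto simp: dist_commute dist_triangle)
qed (use assms in \<open>simp add: Rep_mult Iso_dist[OF Rep_carrier]\<close>)

section \<open>Density and turbulence\<close>

text \<open>
  For any \<open>\<pi>\<close>, the last tuple of a path towards the orbit metric of \<open>\<pi>\<close> imitates the action of \<open>\<pi>\<close> on the
  base points, so a conjugate of \<open>\<alpha>\<close> is close to \<open>\<pi>\<close>.
\<close>

lemma generic_rep_dense_orbit: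
  fixes \<alpha> :: "'a \<Rightarrow> 'u::polish_space \<Rightarrow> 'u"
  assumes u: "is_urysohn_space TYPE('u)" and \<alpha>: "generic_rep \<alpha> z \<rho>"
  shows "Rep_topology G closure_of orbit Iso (conj_action G) \<alpha> = topspace (Rep_topology G)"
proof (intro equalityI closure_of_subset_topspace subsetI)
  have Rep: "\<alpha> \<in> Rep G" and z: "closure (range z) = UNIV" and gen: "generic \<rho>"
    using \<alpha> by (auto simp: generic_rep_def)
  fix \<pi> :: "'a \<Rightarrow> 'u \<Rightarrow> 'u" assume "\<pi> \<in> topspace (Rep_topology G)"
  then have \<pi>: "\<pi> \<in> Rep G" by simp
  show "\<pi> \<in> Rep_topology G closure_of orbit Iso (conj_action G) \<alpha>"
    unfolding in_closure_of
  proof (intro conjI allI impI, simp add: \<pi>)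
    fix U assume "\<pi> \<in> U \<and> openin (Rep_topology G) U"
    then obtain F M \<epsilon> where F: "finite F" "F \<subseteq> carrier G" "\<one> \<in> F" and M: "0 < M" and \<epsilon>: "0 < \<epsilon>"
      and U: "\<And>\<pi>'. \<pi>' \<in> Rep G \<Longrightarrow> \<forall>g\<in>F. \<forall>j<M. dist (\<pi>' g (z j)) (\<pi> g (z j)) < \<epsilon> \<Longrightarrow> \<pi>' \<in> U"
      using Rep_ball_subset[OF is_group z] by metis
    have \<epsilon>2: "0 < \<epsilon> / 2" using \<epsilon> by simp
    define \<tau> where "\<tau> = (\<lambda>(g, i) (h, j). dist (\<pi> g (z i)) (\<pi> h (z j)))"
    have "invariant \<tau>" unfolding \<tau>_def by (rule Rep_orbit_metric_invariant[OF \<pi>])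
    then obtain K s where K: "0 < K" and "\<And>j. j < M \<Longrightarrow> s 0 j = j"
      and slice: "\<And>i g h j k. i \<le> K \<Longrightarrow> g \<in> F \<Longrightarrow> h \<in> F \<Longrightarrow> j < M \<Longrightarrow> k < M \<Longrightarrow>
        \<bar>\<rho> (g, s i j) (h, s i k) -
          ((1 - real i / real K) * \<rho> (g, j) (h, k) + real i / real K * \<tau> (g, j) (h, k))\<bar> < \<epsilon> / 2"
      and "\<And>i j. i < K \<Longrightarrow> j < M \<Longrightarrow> \<rho> (\<one>, s i j) (\<one>, s (Suc i) j) < \<epsilon> / 2"
      by (rule generic_path[OF gen _ F(1,2) M \<epsilon>2]) (rule that; assumption)
    have near: "\<bar>\<rho> (g, s K j) (h, s K k) - dist (\<pi> g (z j)) (\<pi> h (z k))\<bar> \<le> 2 * (\<epsilon> / 4)"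
      if "g \<in> F" "h \<in> F" "j < M" "k < M" for g h j k
      using slice[OF order_refl that] K by (simp add: \<tau>_def)
    have "\<exists>H\<in>carrier Iso. (\<forall>j<M. dist (H (z (s K j))) (z j) \<le> \<epsilon> / 4) \<and>
        (\<forall>g\<in>F. \<forall>j<M. dist (conj_action G H \<alpha> g (z j)) (\<pi> g (z j)) \<le> 2 * (\<epsilon> / 4))"
      by (rule conjugate_near[OF u \<alpha> F M _ _ near]) (use \<epsilon> Rep_one[OF is_group \<pi>] in auto)
    then obtain H where H: "H \<in> carrier Iso"
      "\<And>g j. g \<in> F \<Longrightarrow> j < M \<Longrightarrow> dist (conj_action G H \<alpha> g (z j)) (\<pi> g (z j)) \<le> 2 * (\<epsilon> / 4)"
      by blast
    have "conj_action G H \<alpha> \<in> U"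
    proof (rule U)
      show "conj_action G H \<alpha> \<in> Rep G" by (rule conj_action_Rep[OF H(1) Rep is_group])
      show "\<forall>g\<in>F. \<forall>j<M. dist (conj_action G H \<alpha> g (z j)) (\<pi> g (z j)) < \<epsilon>" using H(2) \<epsilon> by fastforce
    qed
    then show "\<exists>y. y \<in> orbit Iso (conj_action G) \<alpha> \<and> y \<in> U"
      using H(1) by (auto simp: orbit_def)
  qed
qed

text \<open>
  The local orbit is shown to be dense in the neighbourhood \<open>W\<close> of \<open>\<alpha>\<close>, whose radius \<open>\<epsilon>\<close> is a small
  fraction of the radii that define \<open>U\<close> and \<open>V\<close>. Given \<open>\<pi> \<in> W\<close>, take a path of tuples from the base
  points to a tuple that imitates \<open>\<pi>\<close>, and for the \<open>i\<close>-th tuple an isometry \<open>H i\<close> moving it near the base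
  points. Since \<open>\<pi>\<close> and \<open>\<alpha>\<close> are close on the data that define \<open>U\<close>, so are all the interpolated orbit
  metrics, and every conjugate by \<open>H i\<close> stays in \<open>U\<close>. Consecutive tuples are close, so the increments
  \<open>H (i + 1) \<circ> (H i)\<inverse>\<close> move the base points only a little and lie in \<open>V\<close>.
\<close>

lemma generic_rep_turbulent:
  fixes \<alpha> :: "'a \<Rightarrow> 'u::polish_space \<Rightarrow> 'u"
  assumes u: "is_urysohn_space TYPE('u)" and \<alpha>: "generic_rep \<alpha> z \<rho>"
  shows "turbulent_point Iso Iso_topology (Rep_topology G) (conj_action G) \<alpha>"
  unfolding turbulent_point_def
proof (intro conjI allI impI)
  have Rep: "\<alpha> \<in> Rep G" and z: "closure (range z) = UNIV" and gen: "generic \<rho>"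
    and d: "\<And>g h i j. g \<in> carrier G \<Longrightarrow> h \<in> carrier G \<Longrightarrow> dist (\<alpha> g (z i)) (\<alpha> h (z j)) = \<rho> (g, i) (h, j)"
    using \<alpha> by (auto simp: generic_rep_def)
  show "\<alpha> \<in> topspace (Rep_topology G)" using Rep by simp
  interpret I: group "Iso :: ('u \<Rightarrow> 'u) monoid" by (rule group_Iso)
  fix U :: "('a \<Rightarrow> 'u \<Rightarrow> 'u) set" and V :: "('u \<Rightarrow> 'u) set"
  assume UV: "openin (Rep_topology G) U \<and> \<alpha> \<in> U \<and> openin Iso_topology V \<and> \<one>\<^bsub>Iso\<^esub> \<in> V"
  obtain F M\<^sub>1 \<epsilon>\<^sub>1 where F: "finite F" "F \<subseteq> carrier G" "\<one> \<in> F" and M1: "0 < M\<^sub>1" and \<epsilon>1: "0 < \<epsilon>\<^sub>1"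
    and U1: "\<And>\<pi>'. \<pi>' \<in> Rep G \<Longrightarrow> \<forall>g\<in>F. \<forall>j<M\<^sub>1. dist (\<pi>' g (z j)) (\<alpha> g (z j)) < \<epsilon>\<^sub>1 \<Longrightarrow> \<pi>' \<in> U"
    using Rep_ball_subset[OF is_group z] UV by metis
  obtain M\<^sub>2 \<epsilon>\<^sub>2 where \<epsilon>2: "0 < \<epsilon>\<^sub>2"
    and V2: "\<And>f. f \<in> carrier Iso \<Longrightarrow> \<forall>j<M\<^sub>2. dist (f (z j)) (\<one>\<^bsub>Iso\<^esub> (z j)) < \<epsilon>\<^sub>2 \<Longrightarrow> f \<in> V"
    using Iso_ball_subset[OF z, of V "\<one>\<^bsub>Iso\<^esub>"] UV by metis
  define M where "M = max M\<^sub>1 M\<^sub>2"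
  define \<epsilon> where "\<epsilon> = min \<epsilon>\<^sub>1 \<epsilon>\<^sub>2 / 10"
  have M: "0 < M" and \<epsilon>: "0 < \<epsilon>" and \<epsilon>12: "10 * \<epsilon> \<le> \<epsilon>\<^sub>1" "10 * \<epsilon> \<le> \<epsilon>\<^sub>2"
    using M1 \<epsilon>1 \<epsilon>2 by (auto simp: M_def \<epsilon>_def)
  have U: "\<pi>' \<in> U" if "\<pi>' \<in> Rep G" "\<And>g j. g \<in> F \<Longrightarrow> j < M \<Longrightarrow> dist (\<pi>' g (z j)) (\<alpha> g (z j)) \<le> 5 * \<epsilon>" for \<pi>'
  proof (rule U1[OF that(1)], intro ballI allI impI)
    fix g j assume "g \<in> F" "j < M\<^sub>1"
    then have "dist (\<pi>' g (z j)) (\<alpha> g (z j)) \<le> 5 * \<epsilon>" using that(2) by (simp add: M_def)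
    then show "dist (\<pi>' g (z j)) (\<alpha> g (z j)) < \<epsilon>\<^sub>1" using \<epsilon>12 \<epsilon> by linarith
  qed
  have V: "f \<in> V" if "f \<in> carrier Iso" "\<And>j. j < M \<Longrightarrow> dist (f (z j)) (z j) \<le> 5 * \<epsilon>" for f
  proof (rule V2[OF that(1)], intro allI impI)
    fix j assume "j < M\<^sub>2"
    then have "dist (f (z j)) (z j) \<le> 5 * \<epsilon>" using that(2) by (simp add: M_def)
    then show "dist (f (z j)) (\<one>\<^bsub>Iso\<^esub> (z j)) < \<epsilon>\<^sub>2" using \<epsilon>12 \<epsilon> by (simp add: Iso_one)
  qed
  define W where "W = {\<pi> \<in> Rep G. \<forall>g\<in>F. \<forall>j<M. dist (\<pi> g (z j)) (\<alpha> g (z j)) < \<epsilon>}"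
  have "W \<subseteq> Rep_topology G closure_of local_orbit Iso (conj_action G) \<alpha> U V"
  proof
    fix \<pi> assume "\<pi> \<in> W"
    then have \<pi>: "\<pi> \<in> Rep G" and \<pi>\<alpha>: "\<And>g j. g \<in> F \<Longrightarrow> j < M \<Longrightarrow> dist (\<pi> g (z j)) (\<alpha> g (z j)) < \<epsilon>"
      by (auto simp: W_def)
    show "\<pi> \<in> Rep_topology G closure_of local_orbit Iso (conj_action G) \<alpha> U V"
      unfolding in_closure_of
    proof (intro conjI allI impI, simp add: \<pi>)
      fix T assume "\<pi> \<in> T \<and> openin (Rep_topology G) T"
      then obtain F\<^sub>3 M\<^sub>3 \<eta> where F3: "finite F\<^sub>3" "F\<^sub>3 \<subseteq> carrier G" and \<eta>: "0 < \<eta>"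
        and T: "\<And>\<pi>'. \<pi>' \<in> Rep G \<Longrightarrow> \<forall>g\<in>F\<^sub>3. \<forall>j<M\<^sub>3. dist (\<pi>' g (z j)) (\<pi> g (z j)) < \<eta> \<Longrightarrow> \<pi>' \<in> T"
        using Rep_ball_subset[OF is_group z] by metis
      define F' where "F' = F \<union> F\<^sub>3"
      define M' where "M' = max M M\<^sub>3"
      define \<kappa> where "\<kappa> = min \<epsilon> (\<eta> / 4)"
      have F': "finite F'" "F' \<subseteq> carrier G" "\<one> \<in> F'" using F F3 by (auto simp: F'_def)
      have FF': "g \<in> F'" if "g \<in> F" for g using that by (simp add: F'_def)
      have MM': "j < M'" if "j < M" for j using that by (simp add: M'_def)
      have M': "0 < M'" and \<kappa>: "0 < \<kappa>" "\<kappa> \<le> \<epsilon>" "4 * \<kappa> \<le> \<eta>"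
        using M \<epsilon> \<eta> by (auto simp: M'_def \<kappa>_def)
      define \<tau> where "\<tau> = (\<lambda>(g, i) (h, j). dist (\<pi> g (z i)) (\<pi> h (z j)))"
      have "invariant \<tau>" unfolding \<tau>_def by (rule Rep_orbit_metric_invariant[OF \<pi>])
      then obtain K s where K: "0 < K" and s0: "\<And>j. j < M' \<Longrightarrow> s 0 j = j"
        and slice: "\<And>i g h j k. i \<le> K \<Longrightarrow> g \<in> F' \<Longrightarrow> h \<in> F' \<Longrightarrow> j < M' \<Longrightarrow> k < M' \<Longrightarrow>
          \<bar>\<rho> (g, s i j) (h, s i k) -
            ((1 - real i / real K) * \<rho> (g, j) (h, k) + real i / real K * \<tau> (g, j) (h, k))\<bar> < \<kappa>"
        and adj: "\<And>i j. i < K \<Longrightarrow> j < M' \<Longrightarrow> \<rho> (\<one>, s i j) (\<one>, s (Suc i) j) < \<kappa>"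
        by (rule generic_path[OF gen _ F'(1,2) M' \<kappa>(1)]) (rule that; assumption)
      \<comment> \<open>what \<open>H i\<close> has to satisfy; at the end of the path the conjugate must also approximate \<open>\<pi>\<close>
        on the finer data \<open>F'\<close>, \<open>M'\<close>, and at its beginning \<open>H 0\<close> has to be the unit itself\<close>
      define P where "P i H \<longleftrightarrow> H \<in> carrier Iso \<and> (i = 0 \<longrightarrow> H = \<one>\<^bsub>Iso\<^esub>) \<and>
          (i \<le> K \<longrightarrow> (\<forall>j<M. dist (H (z (s i j))) (z j) \<le> 2 * \<epsilon>) \<and>
            (\<forall>g\<in>F. \<forall>j<M. dist (conj_action G H \<alpha> g (z j)) (\<alpha> g (z j)) \<le> 5 * \<epsilon>)) \<and>
          (i = K \<longrightarrow> (\<forall>g\<in>F'. \<forall>j<M'. dist (conj_action G H \<alpha> g (z j)) (\<pi> g (z j)) \<le> 2 * \<kappa>))"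
        for i H
      have "\<exists>H. P i H" for i
      proof -
        consider "i = 0" | "0 < i" "i < K" | "i = K" | "K < i" by linarith
        then show ?thesis
        proof cases
          case 1
          have "P i \<one>\<^bsub>Iso\<^esub>"
            using 1 K s0 MM' \<epsilon> conj_action_one[OF Rep] by (auto simp: P_def Iso_def)
          then show ?thesis by blast
        next
          case 2
          have "\<bar>\<rho> (g, s i j) (h, s i k) - dist (\<alpha> g (z j)) (\<alpha> h (z k))\<bar> \<le> 2 * (2 * \<epsilon>)"
            if *: "g \<in> F" "h \<in> F" "j < M" "k < M" for g h j k
          proof -
            let ?t = "real i / real K"
            have t: "0 \<le> ?t" "?t \<le> 1" using 2 by auto
            have gh: "g \<in> carrier G" "h \<in> carrier G" using * F(2) by auto
            let ?a = "dist (\<alpha> g (z j)) (\<alpha> h (z k))" and ?b = "dist (\<pi> g (z j)) (\<pi> h (z k))"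
            have b: "\<bar>?b - ?a\<bar> \<le> 2 * \<epsilon>"
              using dist_triangle3[of "\<pi> g (z j)" "\<pi> h (z k)" "\<alpha> g (z j)"]
                dist_triangle3[of "\<alpha> g (z j)" "\<alpha> h (z k)" "\<pi> g (z j)"]
                dist_triangle[of "\<alpha> g (z j)" "\<pi> h (z k)" "\<alpha> h (z k)"]
                dist_triangle[of "\<pi> g (z j)" "\<alpha> h (z k)" "\<pi> h (z k)"]
                \<pi>\<alpha>[OF *(1,3)] \<pi>\<alpha>[OF *(2,4)]
              by (simp add: dist_commute)
            define v where "v = ?t * (?b - ?a)"
            have "\<bar>v\<bar> \<le> 1 * (2 * \<epsilon>)"
              unfolding v_def abs_mult using b t by (intro mult_mono) auto
            moreover have "(1 - ?t) * ?a + ?t * ?b = ?a + v" by (simp add: v_def algebra_simps)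
            then have "\<bar>\<rho> (g, s i j) (h, s i k) - (?a + v)\<bar> < \<kappa>"
              using slice[of i g h j k] 2 * FF' MM' d[OF gh] by (simp add: \<tau>_def)
            ultimately show ?thesis using \<kappa>(2) \<epsilon> by linarith
          qed
          then obtain H where H: "H \<in> carrier Iso" "\<forall>j<M. dist (H (z (s i j))) (z j) \<le> 2 * \<epsilon>"
            "\<forall>g\<in>F. \<forall>j<M. dist (conj_action G H \<alpha> g (z j)) (\<alpha> g (z j)) \<le> 2 * (2 * \<epsilon>)"
            using conjugate_near[OF u \<alpha> F M, of "2 * \<epsilon>" "\<lambda>g j. \<alpha> g (z j)" "s i"] \<epsilon> Rep_one[OF is_group Rep]
            by auto
          then have "P i H" using 2 \<epsilon> unfolding P_def by fastforce
          then show ?thesis by blast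
        next
          case 3
          have "\<bar>\<rho> (g, s K j) (h, s K k) - dist (\<pi> g (z j)) (\<pi> h (z k))\<bar> \<le> 2 * \<kappa>"
            if "g \<in> F'" "h \<in> F'" "j < M'" "k < M'" for g h j k
            using slice[OF order_refl that] K \<kappa>(1) by (simp add: \<tau>_def)
          then obtain H where H: "H \<in> carrier Iso" "\<forall>j<M'. dist (H (z (s K j))) (z j) \<le> \<kappa>"
            "\<forall>g\<in>F'. \<forall>j<M'. dist (conj_action G H \<alpha> g (z j)) (\<pi> g (z j)) \<le> 2 * \<kappa>"
            using conjugate_near[OF u \<alpha> F' M', of \<kappa> "\<lambda>g j. \<pi> g (z j)" "s K"] \<kappa>(1) Rep_one[OF is_group \<pi>]
            by auto
          have "dist (conj_action G H \<alpha> g (z j)) (\<alpha> g (z j)) \<le> 5 * \<epsilon>" if "g \<in> F" "j < M" for g j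
          proof -
            have "dist (conj_action G H \<alpha> g (z j)) (\<pi> g (z j)) \<le> 2 * \<kappa>"
              using H(3) FF' MM' that by blast
            then show ?thesis
              using dist_triangle[of "conj_action G H \<alpha> g (z j)" "\<alpha> g (z j)" "\<pi> g (z j)"]
                \<pi>\<alpha>[OF that] \<kappa>(2) \<epsilon> by linarith
          qed
          moreover have "dist (H (z (s K j))) (z j) \<le> 2 * \<epsilon>" if "j < M" for j
            using H(2) MM'[OF that] \<kappa>(2) \<epsilon> by fastforce
          ultimately have "P i H" using 3 K H(1,3) unfolding P_def by blast
          then show ?thesis by blast
        next
          case 4
          then have "P i \<one>\<^bsub>Iso\<^esub>" by (simp add: P_def)
          then show ?thesis by blast
        qed
      qed
      then obtain H where H: "\<And>i. P i (H i)" by metis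
      have HI: "H i \<in> carrier Iso" for i using H[of i] by (simp add: P_def)
      have H0: "H 0 = \<one>\<^bsub>Iso\<^esub>" using H[of 0] by (simp add: P_def)
      have Hz: "dist (H i (z (s i j))) (z j) \<le> 2 * \<epsilon>" if "i \<le> K" "j < M" for i j
        using H[of i] that unfolding P_def by blast
      have HU: "conj_action G (H i) \<alpha> \<in> U" if "i \<le> K" for i
        by (rule U[OF conj_action_Rep[OF HI Rep is_group]]) (use H[of i] that in \<open>auto simp: P_def\<close>)
      have HT: "conj_action G (H K) \<alpha> \<in> T"
      proof (rule T[OF conj_action_Rep[OF HI Rep is_group]], intro ballI allI impI)
        fix g j assume "g \<in> F\<^sub>3" "j < M\<^sub>3"
        then have "dist (conj_action G (H K) \<alpha> g (z j)) (\<pi> g (z j)) \<le> 2 * \<kappa>"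
          using H[of K] unfolding P_def F'_def M'_def by auto
        then show "dist (conj_action G (H K) \<alpha> g (z j)) (\<pi> g (z j)) < \<eta>" using \<kappa> by linarith
      qed
      define f where "f i = H i \<otimes>\<^bsub>Iso\<^esub> inv\<^bsub>Iso\<^esub> H (i - 1)" for i
      have wp: "word_prod Iso f n = H n" for n
        unfolding f_def by (rule word_prod_telescope[where H = H, OF group_Iso HI H0])
      have fV: "f (Suc i) \<in> V" if i: "i < K" for i
      proof (rule V)
        show "f (Suc i) \<in> carrier Iso" using HI by (simp add: f_def)
        fix j assume j: "j < M"
        define x where "x = (inv\<^bsub>Iso\<^esub> H i) (z j)"
        have Hx: "H i x = z j" unfolding x_def by (rule Iso_inv_apply(1)[OF HI])
        have fx: "f (Suc i) (z j) = H (Suc i) x" by (simp add: f_def x_def Iso_mult)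
        have "dist (z (s i j)) (z (s (Suc i) j)) < \<kappa>"
          using adj[OF i MM'[OF j]] d[OF one_closed one_closed, of "s i j" "s (Suc i) j"]
          by (simp add: Rep_one[OF is_group Rep])
        moreover have "dist x (z (s i j)) \<le> 2 * \<epsilon>"
          using Hz[of i j] i j Iso_dist[OF HI, of i x "z (s i j)"] by (simp add: Hx dist_commute)
        moreover have "dist (H (Suc i) x) (z j) \<le> dist x (z (s (Suc i) j)) + 2 * \<epsilon>"
          using dist_triangle[of "H (Suc i) x" "z j" "H (Suc i) (z (s (Suc i) j))"] Hz[of "Suc i" j] i j
            Iso_dist[OF HI, of "Suc i" x "z (s (Suc i) j)"] by simp
        ultimately show "dist (f (Suc i) (z j)) (z j) \<le> 5 * \<epsilon>"
          using dist_triangle[of x "z (s (Suc i) j)" "z (s i j)"] \<kappa>(2) unfolding fx by linarith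
      qed
      have "conj_action G (H K) \<alpha> \<in> local_orbit Iso (conj_action G) \<alpha> U V"
        unfolding local_orbit_def
      proof (intro CollectI conjI exI ballI)
        show "conj_action G (H K) \<alpha> \<in> U" by (rule HU) simp
        show "conj_action G (H K) \<alpha> = conj_action G (word_prod Iso f K) \<alpha>" by (simp add: wp)
        fix i assume i: "i \<in> {1..K}"
        then show "conj_action G (word_prod Iso f i) \<alpha> \<in> U" using HU by (simp add: wp)
        obtain k where "i = Suc k" "k < K" using i by (cases i) auto
        then show "f i \<in> V" using fV by simp
      qed
      then show "\<exists>y. y \<in> local_orbit Iso (conj_action G) \<alpha> U V \<and> y \<in> T" using HT by blast
    qed
  qed
  moreover have "openin (Rep_topology G) W"
    unfolding W_def by (rule openin_Rep_ball[OF F(1,2)])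
  moreover have "\<alpha> \<in> W" using Rep \<epsilon> by (simp add: W_def)
  ultimately show "Rep_topology G interior_of (Rep_topology G closure_of
      local_orbit Iso (conj_action G) \<alpha> U V) \<noteq> {}"
    using interior_of_maximal by blast
qed

end

theorem theorem3p11:
  fixes \<Gamma> :: "('g, 'm) monoid_scheme"
  assumes "is_urysohn_space TYPE('u::polish_space)"
    and "group \<Gamma>" and "countable (carrier \<Gamma>)" and "infinite (carrier \<Gamma>)"
  shows "\<exists>\<alpha> \<in> (Rep \<Gamma> :: ('g \<Rightarrow> 'u \<Rightarrow> 'u) set).
           Rep_topology \<Gamma> closure_of orbit Iso (conj_action \<Gamma>) \<alpha> = topspace (Rep_topology \<Gamma>) \<and>
           turbulent_point Iso Iso_topology (Rep_topology \<Gamma>) (conj_action \<Gamma>) \<alpha>"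
proof -
  interpret countable_group \<Gamma>
    using assms(2,3) by (simp add: countable_group_def countable_group_axioms_def)
  obtain \<alpha> :: "'g \<Rightarrow> 'u \<Rightarrow> 'u" and z \<rho> where \<alpha>: "generic_rep \<alpha> z \<rho>"
    using exists_generic_rep[OF assms(1)] by blast
  then have "\<alpha> \<in> Rep \<Gamma>" by (simp add: generic_rep_def)
  then show ?thesis
    using generic_rep_dense_orbit[OF assms(1) \<alpha>] generic_rep_turbulent[OF assms(1) \<alpha>] by blast
qed

end
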